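(* Let $\nu\ge2$, and let $\mathcal M'_0$, $\mathcal M'_z$, $\Xi'$ be as defined in the context (real coefficients with respect to $\omega$). If $\nu=2$, then the group $\mathcal M'_0$ is trivial. If $\nu>2$, then the group $\mathcal M'_0$ is not trivial and is the free product of its subgroups $\mathcal M'_z$ for all $z\in\Xi'$. The groups $\mathcal M'_z$, $z\in\Xi'$, are commutative.
   Context: Fix an integer $\nu\ge2$ and let $D=\mathrm{diag}\{-1,1,\dots,1\}$ be $\nu\times\nu$; $I$ is the $\nu\times\nu$ identity. A polynomial matrix is $U(\omega)=\sum_{\iota=0}^{\kappa}U_\iota\omega^\iota$ with constant complex matrices $U_\iota$ (vectors and scalars included). The variable $\omega$ is regarded as real, and $U(\omega)^*=\sum_\iota U_\iota^*\omega^\iota$, where $U_\iota^*$ is the Hermitian conjugate of $U_\iota$ (the transpose if $U_\iota$ is real). $\mathcal M$ is the group of all $\nu\times\nu$ polynomial matrices $U(\omega)$ with $U(\omega)\,D\,U(\omega)^*=D$. $\mathcal M'$ is the subgroup of those $U\in\mathcal M$ all of whose coefficients $U_\iota$ are real matrices, and $\mathcal M'_0=\{U\in\mathcal M'\mid U(0)=I\}$. $\Xi'=\{z=\mathrm{column}\{\zeta_1,\dots,\zeta_\nu\}\in\mathbb R^\nu\mid\zeta_1=1,\ z^*Dz=0\}$. For $z\in\Xi'$, $\Delta'_z$ is the set of vector polynomials $g=g_1\omega+g_2\omega^2+\cdots$ (finite sums, no constant term) with real vectors $g_\iota\in\mathbb R^\nu$ satisfying $g_\iota^*z=g_\iota^*Dz=0$.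 $\Phi'$ is the set of real scalar polynomials $\phi(\omega)$ with $\phi(0)=0$ and $\phi^*=-\phi$; thus $\Phi'=\{0\}$. For $z\in\Xi'$, $\phi\in\Phi'$, $g\in\Delta'_z$: $$G_z(\phi,g)=D\big[z(\phi-\tfrac12 g^*g)z^*+(zg^*-gz^* )\big]+I,$$ and $\mathcal M'_z=\{G_z(\phi,g)\mid\phi\in\Phi',\ g\in\Delta'_z\}=\{G_z(0,g)\mid g\in\Delta'_z\}$. *)

theory Defs
  imports "HOL-Computational_Algebra.Polynomial" "Jordan_Normal_Form.Matrix"
    "HOL-Algebra.Elementary_Groups"
begin

text \<open>Internal free product of an indexed family of subgroups (Kurosh): every element is the product of
  exactly one reduced word. Letters carry their index, and the unit is the product of the empty word.\<close>

definition reduced_word :: "('a, 'b) monoid_scheme \<Rightarrow> 'i set \<Rightarrow> ('i \<Rightarrow> 'a set) \<Rightarrow> ('i \<times> 'a) list \<Rightarrow> bool"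
  where "reduced_word G I H w \<longleftrightarrow>
    (\<forall>(i, h) \<in> set w. i \<in> I \<and> h \<in> H i \<and> h \<noteq> \<one>\<^bsub>G\<^esub>) \<and> successively (\<lambda>p q. fst p \<noteq> fst q) w"

definition word_product :: "('a, 'b) monoid_scheme \<Rightarrow> ('i \<times> 'a) list \<Rightarrow> 'a"
  where "word_product G w = foldr (\<lambda>(i, h) x. h \<otimes>\<^bsub>G\<^esub> x) w \<one>\<^bsub>G\<^esub>"

definition is_free_product_of :: "('a, 'b) monoid_scheme \<Rightarrow> 'i set \<Rightarrow> ('i \<Rightarrow> 'a set) \<Rightarrow> bool"
  where "is_free_product_of G I H \<longleftrightarrow>
    group G \<and> (\<forall>i\<in>I. subgroup (H i) G) \<and>
    (\<forall>x\<in>carrier G. \<exists>!w. reduced_word G I H w \<and> word_product G w = x)"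

text \<open>The indeterminate is regarded as a real variable, so conjugation acts on the coefficients.\<close>

instantiation poly :: ("{conjugatable_ring, comm_ring}") conjugatable_ring
begin

definition conjugate_poly :: "'a poly \<Rightarrow> 'a poly"
  where "conjugate_poly p = map_poly conjugate p"

lemma coeff_conjugate_poly: "coeff (conjugate p) k = conjugate (coeff p k)" for p :: "'a poly"
  by (simp add: conjugate_poly_def coeff_map_poly)

instance
proof
  fix p q :: "'a poly"
  show "conjugate (conjugate p) = p"
    by (simp add: poly_eq_iff coeff_conjugate_poly)
  show "conjugate p = conjugate q \<longleftrightarrow> p = q"
    by (simp add: poly_eq_iff coeff_conjugate_poly)
  show "conjugate (p * q) = conjugate p * conjugate q"
    by (simp add: poly_eq_iff coeff_conjugate_poly coeff_mult sum_conjugate conjugate_dist_mul)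
  show "conjugate (p + q) = conjugate p + conjugate q"
    by (simp add: poly_eq_iff coeff_conjugate_poly conjugate_dist_add)
  show "conjugate (- p) = - conjugate p"
    by (simp add: poly_eq_iff coeff_conjugate_poly conjugate_neg)
  show "conjugate (0 :: 'a poly) = 0"
    by (simp add: poly_eq_iff coeff_conjugate_poly)
qed

end

text \<open>\<open>mat_adjoint\<close> from the library is restricted to fields.\<close>

definition mat_star :: "'a :: conjugate mat \<Rightarrow> 'a mat"
  where "mat_star A = map_mat conjugate (transpose_mat A)"

text \<open>\<open>outer u v\<close> is the matrix \<open>u v\<^sup>*\<close>; correspondingly \<open>u \<bullet>c v\<close> is the scalar \<open>v\<^sup>* u\<close>.\<close>

definition outer :: "'a :: conjugatable_ring vec \<Rightarrow> 'a vec \<Rightarrow> 'a mat"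
  where "outer u v = mat (dim_vec u) (dim_vec v) (\<lambda>(i, j). u $ i * conjugate (v $ j))"

definition Dmat :: "nat \<Rightarrow> 'a :: ring_1 mat"
  where "Dmat n = mat_diag n (\<lambda>i. if i = 0 then - 1 else 1)"

abbreviation const_vec :: "'a :: zero vec \<Rightarrow> 'a poly vec"
  where "const_vec \<equiv> map_vec (\<lambda>c. [:c:])"

abbreviation coeff_vec :: "'a :: zero poly vec \<Rightarrow> nat \<Rightarrow> 'a vec"
  where "coeff_vec g k \<equiv> map_vec (\<lambda>p. coeff p k) g"

abbreviation coeff_mat :: "'a :: zero poly mat \<Rightarrow> nat \<Rightarrow> 'a mat"
  where "coeff_mat U k \<equiv> map_mat (\<lambda>p. coeff p k) U"

definition real_vec :: "complex vec \<Rightarrow> bool"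
  where "real_vec v \<longleftrightarrow> (\<forall>i<dim_vec v. v $ i \<in> \<real>)"

definition real_mat :: "complex mat \<Rightarrow> bool"
  where "real_mat A \<longleftrightarrow> (\<forall>i<dim_row A. \<forall>j<dim_col A. A $$ (i, j) \<in> \<real>)"

text \<open>Polynomial matrices are represented as matrices over the polynomial ring.\<close>

definition M :: "nat \<Rightarrow> complex poly mat monoid"
  where "M n = \<lparr>carrier = {U \<in> carrier_mat n n. U * Dmat n * mat_star U = Dmat n},
                mult = (*), one = 1\<^sub>m n\<rparr>"

definition M_real :: "nat \<Rightarrow> complex poly mat set"
  where "M_real n = {U \<in> carrier (M n). \<forall>k. real_mat (coeff_mat U k)}"

definition M_real0 :: "nat \<Rightarrow> complex poly mat set"
  where "M_real0 n = {U \<in> M_real n. map_mat (\<lambda>p. poly p 0) U = 1\<^sub>m n}"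

definition Xi_real :: "nat \<Rightarrow> complex vec set"
  where "Xi_real n = {z \<in> carrier_vec n. real_vec z \<and> z $ 0 = 1 \<and> (Dmat n *\<^sub>v z) \<bullet>c z = 0}"

definition Delta_real :: "nat \<Rightarrow> complex vec \<Rightarrow> complex poly vec set"
  where "Delta_real n z = {g \<in> carrier_vec n. coeff_vec g 0 = 0\<^sub>v n \<and>
    (\<forall>k. real_vec (coeff_vec g k) \<and>
         z \<bullet>c coeff_vec g k = 0 \<and> (Dmat n *\<^sub>v z) \<bullet>c coeff_vec g k = 0)}"

definition Phi_real :: "complex poly set"
  where "Phi_real = {\<phi>. (\<forall>k. coeff \<phi> k \<in> \<real>) \<and> poly \<phi> 0 = 0 \<and> conjugate \<phi> = - \<phi>}"

definition G_mat :: "nat \<Rightarrow> complex vec \<Rightarrow> complex poly \<Rightarrow> complex poly vec \<Rightarrow> complex poly mat"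
  where "G_mat n z \<phi> g =
    (let zp = const_vec z in
      Dmat n * ((\<phi> - Polynomial.smult (1/2) (g \<bullet>c g)) \<cdot>\<^sub>m outer zp zp + (outer zp g - outer g zp)) + 1\<^sub>m n)"

definition M_real_at :: "nat \<Rightarrow> complex vec \<Rightarrow> complex poly mat set"
  where "M_real_at n z = {G_mat n z \<phi> g |\<phi> g. \<phi> \<in> Phi_real \<and> g \<in> Delta_real n z}"

abbreviation M_real0_group :: "nat \<Rightarrow> complex poly mat monoid"
  where "M_real0_group n \<equiv> (M n)\<lparr>carrier := M_real0 n\<rparr>"

end

theory Submission
  imports Defs "Jordan_Normal_Form.Determinant"
begin

text \<open>
  For null vectors \<open>z \<noteq> w\<close> in \<open>\<Xi>'\<close> one has \<open>z\<^sup>T D w \<noteq> 0\<close>, and for \<open>g \<noteq> 0\<close> of degree \<open>m\<close> the leading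
  coefficient of \<open>G\<^sub>z(0, g)\<close> is a nonzero multiple of \<open>D z z\<^sup>T\<close> in degree \<open>2 m\<close>. Hence the product of a
  reduced word starting in \<open>M'\<^sub>z\<close> is nonconstant with leading coefficient \<open>D z b\<^sup>T\<close>, so it determines \<open>z\<close>;
  this gives uniqueness.

  For existence, let \<open>U\<close> have degree \<open>d > 0\<close>. The columns of its leading coefficient are isotropic and
  mutually orthogonal, so they lie on a line spanned by some \<open>D z\<close>, and \<open>z\<^sup>T U\<close> has degree \<open>m < d\<close>.
  Left multiplication by \<open>G\<^sub>z(0, g)\<close> does not change \<open>z\<^sup>T U\<close>, and acts on a column \<open>x\<close> modulo \<open>D z\<close> by
  subtracting \<open>(z\<^sup>T x) g\<close>. Dividing by an entry of \<open>z\<^sup>T U\<close> of degree \<open>m\<close> yields \<open>g\<close> for which one column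
  of \<open>G\<^sub>z(0, g) U\<close> has degree at most \<open>m\<close>, and the relation \<open>V\<^sup>T D V = D\<close> for
  \<open>V = G\<^sub>z(0, g) U\<close> then bounds the degree of all other columns by \<open>m\<close> as well.
\<close>

section \<open>Free products\<close>

lemma word_product_Nil [simp]: "word_product G [] = \<one>\<^bsub>G\<^esub>"
  by (simp add: word_product_def)

lemma word_product_Cons [simp]:
  "word_product G ((i, h) # w) = h \<otimes>\<^bsub>G\<^esub> word_product G w"
  by (simp add: word_product_def)

lemma reduced_word_Nil [simp]: "reduced_word G I H []"
  by (simp add: reduced_word_def)

lemma reduced_word_Cons:
  "reduced_word G I H ((i, h) # w) \<longleftrightarrow> i \<in> I \<and> h \<in> H i \<and> h \<noteq> \<one>\<^bsub>G\<^esub> \<and>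
     (w = [] \<or> i \<noteq> fst (hd w)) \<and> reduced_word G I H w"
  by (auto simp: reduced_word_def successively_Cons)

lemma (in group) word_product_closed:
  assumes "\<And>i. i \<in> I \<Longrightarrow> subgroup (H i) G" "reduced_word G I H w"
  shows "word_product G w \<in> carrier G"
  using assms(2)
proof (induction w)
  case (Cons p w)
  obtain i h where p: "p = (i, h)" by (cases p)
  with Cons assms(1) show ?case
    by (auto simp: reduced_word_Cons dest: subgroup.mem_carrier)
qed simp

text \<open>A new letter is dropped if trivial, put in front if its index differs from the first
  one, and otherwise merged with the first letter. If the merged letter is trivial it disappears,
  and the remaining word is already reduced, so no further cancellation occurs.\<close>

lemma (in group) reduced_word_prepend:
  assumes H: "\<And>i. i \<in> I \<Longrightarrow> subgroup (H i) G"
    and w: "reduced_word G I H w" and i: "i \<in> I" "h \<in> H i"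
  shows "\<exists>v. reduced_word G I H v \<and> word_product G v = h \<otimes> word_product G w"
proof -
  have hc: "h \<in> carrier G" and wc: "word_product G w \<in> carrier G"
    using H i w word_product_closed subgroup.mem_carrier by metis+
  consider "h = \<one>" | "h \<noteq> \<one>" "w = [] \<or> i \<noteq> fst (hd w)"
    | k v where "h \<noteq> \<one>" "w = (i, k) # v"
    by (metis list.exhaust_sel prod.collapse)
  then show ?thesis
  proof cases
    case 1
    then show ?thesis using w wc by auto
  next
    case 2
    then have "reduced_word G I H ((i, h) # w)" using w i by (auto simp: reduced_word_Cons)
    then show ?thesis by (metis word_product_Cons)
  next
    case 3
    then have k: "k \<in> H i" and v: "reduced_word G I H v" "v = [] \<or> i \<noteq> fst (hd v)"
      using w by (auto simp: reduced_word_Cons)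
    have kc: "k \<in> carrier G" and vc: "word_product G v \<in> carrier G"
      using H i k v word_product_closed subgroup.mem_carrier by metis+
    have hk: "h \<otimes> k \<in> H i" using H i k subgroup.m_closed by metis
    have prod: "h \<otimes> word_product G w = (h \<otimes> k) \<otimes> word_product G v"
      using 3 hc kc vc by (simp add: m_assoc)
    show ?thesis
    proof (cases "h \<otimes> k = \<one>")
      case True
      then show ?thesis using prod v vc by auto
    next
      case False
      then have "reduced_word G I H ((i, h \<otimes> k) # v)"
        using v hk i by (auto simp: reduced_word_Cons)
      then show ?thesis using prod by (metis word_product_Cons)
    qed
  qed
qed

text \<open>A criterion in the spirit of ping-pong: \<open>Q\<close> is an invariant of group
  elements that recovers the index of the first letter and fails for the unit. Equal products then
  have equal first indices, and induction on the word only has to compare the first letters.\<close>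

lemma is_free_product_ofI:
  fixes G (structure)
  assumes "group G" and H: "\<And>i. i \<in> I \<Longrightarrow> subgroup (H i) G"
    and gen: "\<And>x. x \<in> carrier G \<Longrightarrow> \<exists>w. reduced_word G I H w \<and> word_product G w = x"
    and first: "\<And>i h w. reduced_word G I H ((i, h) # w) \<Longrightarrow> Q i (word_product G ((i, h) # w))"
    and inj: "\<And>i j x. \<lbrakk>i \<in> I; j \<in> I; Q i x; Q j x\<rbrakk> \<Longrightarrow> i = j"
    and one: "\<And>i. i \<in> I \<Longrightarrow> \<not> Q i \<one>\<^bsub>G\<^esub>"
  shows "is_free_product_of G I H"
proof -
  interpret group G by fact
  have uniq: "w = v" if "reduced_word G I H w" "reduced_word G I H v"
      "word_product G w = word_product G v" for w v
    using that
  proof (induction w arbitrary: v)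
    case Nil
    then show ?case
      by (metis first one word_product_Nil reduced_word_Cons list.exhaust prod.exhaust)
  next
    case (Cons p w)
    obtain i a where p: "p = (i, a)" by (cases p)
    have "v \<noteq> []"
      using Cons.prems first one unfolding p by (metis word_product_Nil reduced_word_Cons)
    then obtain j b u where v: "v = (j, b) # u" by (metis list.exhaust prod.exhaust)
    have [simp]: "i \<in> I" "j \<in> I" using Cons.prems by (auto simp: p v reduced_word_Cons)
    have ij: "i = j"
      using Cons.prems first[of i a w] first[of j b u] by (auto simp: p v intro: inj)
    have w: "reduced_word G I H w" and u: "reduced_word G I H u"
      and ab: "a \<in> H i" "b \<in> H i" and u': "u = [] \<or> i \<noteq> fst (hd u)"
      and w': "w = [] \<or> i \<noteq> fst (hd w)"
      using Cons.prems by (auto simp: p v reduced_word_Cons ij)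
    have c: "a \<in> carrier G" "b \<in> carrier G" "word_product G w \<in> carrier G" "word_product G u \<in> carrier G"
      using ab w u H word_product_closed subgroup.mem_carrier \<open>i \<in> I\<close> by metis+
    have eq: "(inv b \<otimes> a) \<otimes> word_product G w = word_product G u"
      using Cons.prems(3) c by (simp add: p v m_assoc inv_solve_left')
    \<comment> \<open>If the letters differed, \<open>inv b \<otimes> a\<close> would be a
      nontrivial letter and \<open>(i, inv b \<otimes> a) # w\<close> a reduced word with the
      product of \<open>u\<close>. But \<open>u\<close> is empty or begins with another index,
      against \<open>Q\<close>.\<close>
    have "a = b"
    proof (rule ccontr)
      assume "a \<noteq> b"
      then have "inv b \<otimes> a \<noteq> \<one>" using c by (metis inv_closed inv_equality inv_inv)
      moreover have "inv b \<otimes> a \<in> H i"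
        using ab H[OF \<open>i \<in> I\<close>] by (simp add: subgroup.m_closed subgroup.m_inv_closed)
      ultimately have "Q i (word_product G u)"
        using first[of i "inv b \<otimes> a" w] w w' eq by (simp add: reduced_word_Cons)
      then show False
        using u' u one[of i] first inj \<open>i \<in> I\<close>
        by (metis fst_conv list.sel(1) list.exhaust prod.exhaust reduced_word_Cons word_product_Nil)
    qed
    then have "word_product G w = word_product G u"
      using eq c by simp
    then show ?case using Cons.IH[OF w u] \<open>a = b\<close> ij by (simp add: p v)
  qed
  show ?thesis
    unfolding is_free_product_of_def using \<open>group G\<close> H gen uniq by blast
qed

section \<open>Eichler transformations\<close>

text \<open>Vectors are plain functions of which only the values below \<open>n\<close> count. The
  pairing is bilinear, without conjugation; for real coefficients it agrees with the Hermitian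
  one.\<close>

definition dot :: "nat \<Rightarrow> (nat \<Rightarrow> 'a :: comm_ring_1) \<Rightarrow> (nat \<Rightarrow> 'a) \<Rightarrow> 'a"
  where "dot n f g = (\<Sum>i<n. f i * g i)"

text \<open>This is the action of \<open>D\<close>, so \<open>dot n f (flip g)\<close> is the
  Lorentzian form \<open>f^T D g\<close>.\<close>

definition flip :: "(nat \<Rightarrow> 'a :: comm_ring_1) \<Rightarrow> nat \<Rightarrow> 'a"
  where "flip f i = (if i = 0 then - f i else f i)"

lemma dot_commute: "dot n f g = dot n g f"
  by (simp add: dot_def mult.commute)

lemma dot_cong: "(\<And>i. i < n \<Longrightarrow> f i = f' i) \<Longrightarrow> (\<And>i. i < n \<Longrightarrow> g i = g' i) \<Longrightarrow> dot n f g = dot n f' g'"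
  by (simp add: dot_def)

lemma dot_linear:
  "dot n f (\<lambda>i. g i + h i) = dot n f g + dot n f h"
  "dot n f (\<lambda>i. g i - h i) = dot n f g - dot n f h"
  "dot n f (\<lambda>i. c * g i) = c * dot n f g"
  "dot n (\<lambda>i. g i + h i) f = dot n g f + dot n h f"
  "dot n (\<lambda>i. g i - h i) f = dot n g f - dot n h f"
  "dot n (\<lambda>i. c * g i) f = c * dot n g f"
  by (simp_all add: dot_def sum.distrib sum_subtractf sum_distrib_left algebra_simps)

lemma flip_flip [simp]: "flip (flip f) = f"
  by (auto simp: flip_def)

lemma dot_flip_left: "dot n (flip f) g = dot n f (flip g)"
  unfolding dot_def by (rule sum.cong) (auto simp: flip_def)

lemma flip_linear:
  "flip (\<lambda>i. g i + h i) = (\<lambda>i. flip g i + flip h i)"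
  "flip (\<lambda>i. g i - h i) = (\<lambda>i. flip g i - flip h i)"
  "flip (\<lambda>i. c * g i) = (\<lambda>i. c * flip g i)"
  by (auto simp: flip_def)

lemma dot_unit: "j < n \<Longrightarrow> dot n f (\<lambda>k. if k = j then 1 else 0) = f j"
  by (simp add: dot_def if_distrib cong: if_cong)

abbreviation half :: "complex poly" where "half \<equiv> [:1/2:]"

lemma half_half: "half + half = 1"
  by (simp add: one_pCons)

lemma half_double: "half * x + half * x = x"
  by (metis half_half distrib_right mult_1)

text \<open>The Eichler (or Siegel) transformation of the isotropic vector \<open>D \<zeta>\<close>.
  For \<open>\<zeta> = z\<close> and \<open>\<gamma> = g\<close> it is the action of
  \<open>G_mat n z 0 g\<close> on a column \<open>x\<close>.\<close>

definition eichler :: "nat \<Rightarrow> (nat \<Rightarrow> complex poly) \<Rightarrow> (nat \<Rightarrow> complex poly) \<Rightarrow> (nat \<Rightarrow> complex poly) \<Rightarrow> nat \<Rightarrow> complex poly"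
  where "eichler n \<zeta> \<gamma> x i =
    x i + ((dot n \<gamma> x - half * dot n \<gamma> \<gamma> * dot n \<zeta> x) * flip \<zeta> i - dot n \<zeta> x * flip \<gamma> i)"

lemma eichler_cong:
  assumes "\<And>i. i < n \<Longrightarrow> \<gamma> i = \<gamma>' i" "\<And>i. i < n \<Longrightarrow> x i = x' i" "i < n"
  shows "eichler n \<zeta> \<gamma> x i = eichler n \<zeta> \<gamma>' x' i"
  using assms unfolding eichler_def by (simp add: flip_def cong: dot_cong)

lemma eichler_zero: "(\<And>i. i < n \<Longrightarrow> \<gamma> i = 0) \<Longrightarrow> i < n \<Longrightarrow> eichler n \<zeta> \<gamma> x i = x i"
  by (simp add: eichler_def flip_def dot_def)

text \<open>The displacement is a combination of \<open>D \<zeta>\<close> and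
  \<open>D \<gamma>\<close>, both of which \<open>\<zeta>\<close> annihilates.\<close>

lemma dot_eichler:
  assumes "dot n \<zeta> (flip \<zeta>) = 0" "dot n \<zeta> (flip \<gamma>) = 0"
  shows "dot n \<zeta> (eichler n \<zeta> \<gamma> x) = dot n \<zeta> x"
  using assms by (simp add: eichler_def[abs_def] dot_linear)

text \<open>The linear terms simply add. The quadratic term fits because pairing
  \<open>\<gamma>\<close> with the displacement by \<open>\<delta>\<close> produces exactly the
  cross term \<open>dot n \<gamma> \<delta>\<close> in half the square of
  \<open>\<gamma> + \<delta>\<close>.\<close>

lemma eichler_eichler:
  assumes z: "dot n \<zeta> (flip \<zeta>) = 0"
    and g: "dot n \<zeta> \<gamma> = 0" "flip \<gamma> = \<gamma>"
    and d: "dot n \<zeta> \<delta> = 0" "flip \<delta> = \<delta>"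
  shows "eichler n \<zeta> \<gamma> (eichler n \<zeta> \<delta> x) = eichler n \<zeta> (\<lambda>i. \<gamma> i + \<delta> i) x"
proof
  fix i
  have a: "dot n \<zeta> (eichler n \<zeta> \<delta> x) = dot n \<zeta> x"
    by (rule dot_eichler) (use z d in auto)
  have "dot n \<gamma> (flip \<zeta>) = 0" using g dot_flip_left[of n \<gamma> \<zeta>] by (simp add: dot_commute)
  then have b: "dot n \<gamma> (eichler n \<zeta> \<delta> x) = dot n \<gamma> x - dot n \<zeta> x * dot n \<gamma> \<delta>"
    using d by (simp add: eichler_def[abs_def] dot_linear)
  have c: "dot n (\<lambda>i. \<gamma> i + \<delta> i) (\<lambda>i. \<gamma> i + \<delta> i) = dot n \<gamma> \<gamma> + dot n \<delta> \<delta> + (dot n \<gamma> \<delta> + dot n \<gamma> \<delta>)"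
    by (simp add: dot_linear dot_commute[of n \<delta> \<gamma>])
  have c': "half * dot n (\<lambda>i. \<gamma> i + \<delta> i) (\<lambda>i. \<gamma> i + \<delta> i) = half * dot n \<gamma> \<gamma> + half * dot n \<delta> \<delta> + dot n \<gamma> \<delta>"
    unfolding c distrib_left half_double by simp
  have f: "flip (\<lambda>i. \<gamma> i + \<delta> i) = (\<lambda>i. \<gamma> i + \<delta> i)"
    using g d by (simp add: flip_linear)
  show "eichler n \<zeta> \<gamma> (eichler n \<zeta> \<delta> x) i = eichler n \<zeta> (\<lambda>i. \<gamma> i + \<delta> i) x i"
    unfolding eichler_def[of n \<zeta> \<gamma>] eichler_def[of n \<zeta> "\<lambda>i. \<gamma> i + \<delta> i"] a b c' f
    unfolding eichler_def[of n \<zeta> \<delta>]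
    using g d by (simp only: dot_linear) (simp only: algebra_simps)
qed

lemma eichler_isometry:
  assumes z: "dot n \<zeta> (flip \<zeta>) = 0" and g: "dot n \<zeta> \<gamma> = 0" "flip \<gamma> = \<gamma>"
  shows "dot n (eichler n \<zeta> \<gamma> x) (flip (eichler n \<zeta> \<gamma> y)) = dot n x (flip y)"
proof -
  have e: "eichler n \<zeta> \<gamma> u = (\<lambda>i. u i + ((dot n \<gamma> u - half * dot n \<gamma> \<gamma> * dot n \<zeta> u) * flip \<zeta> i - dot n \<zeta> u * \<gamma> i))" for u
    by (rule ext) (simp add: eichler_def g)
  have 1: "dot n \<gamma> (flip u) = dot n \<gamma> u" "dot n (flip \<zeta>) u = dot n \<zeta> (flip u)"
     "dot n x \<gamma> = dot n \<gamma> x" "dot n x \<zeta> = dot n \<zeta> x" "dot n \<gamma> \<zeta> = 0" for u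
    using dot_flip_left[of n \<gamma> u] dot_flip_left[of n \<zeta> u] g
    by (simp_all add: dot_commute[of n x] dot_commute[of n \<gamma> \<zeta>])
  \<comment> \<open>The letters stand for \<open>s = x^T D y\<close>,
    \<open>p = \<gamma>^T x\<close>, \<open>r = \<gamma>^T y\<close>,
    \<open>b = \<zeta>^T x\<close>, \<open>c = \<zeta>^T y\<close>,
    \<open>q = \<gamma>^T \<gamma>\<close> and \<open>h = half\<close>. With \<open>h\<close>
    generic this is a ring identity whose error has the factor \<open>1 - (h + h)\<close>, so the
    coefficient one half is what makes the map an isometry.\<close>
  have gen: "s + ((p - h * q * b) * c - b * r) + ((r - h * q * c) * (b + ((p - h * q * b) * 0 - b * 0))
      - c * (p + ((p - h * q * b) * 0 - b * q))) = s + (1 - (h + h)) * (b * c * q)" for s p q r b c h :: "complex poly"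
    by (simp add: algebra_simps)
  show ?thesis
    unfolding e dot_linear flip_linear 1 z g flip_flip
    by (subst gen) (simp add: half_half)
qed

section \<open>The group of real polynomial matrices\<close>

lemma mat_mult_assoc:
  fixes A B C :: "'a :: semiring_0 mat"
  assumes "dim_col A = dim_row B" "dim_col B = dim_row C"
  shows "A * B * C = A * (B * C)"
  by (rule assoc_mult_mat[of A "dim_row A" "dim_row B" B "dim_row C" C "dim_col C"]) (use assms in auto)

text \<open>The entries lie in an integral domain, not in a field: multiplying by the adjugate gives
  \<open>adj_mat A = det A \<cdot>\<^sub>m B\<close>, and the determinant, being a divisor of 1, can
  be cancelled.\<close>

lemma mat_right_inverse_imp_left:
  fixes A :: "'a :: idom mat"
  assumes A: "A \<in> carrier_mat n n" and B: "B \<in> carrier_mat n n" and AB: "A * B = 1\<^sub>m n"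
  shows "B * A = 1\<^sub>m n"
proof -
  have "det A * det B = 1" using det_mult[OF A B] AB by simp
  then have d: "det A \<noteq> 0" by auto
  have adj: "adj_mat A \<in> carrier_mat n n" using adj_mat[OF A] by simp
  have "adj_mat A = adj_mat A * (A * B)" using adj AB by simp
  also have "\<dots> = (adj_mat A * A) * B" using adj A B by (simp add: mat_mult_assoc)
  also have "\<dots> = det A \<cdot>\<^sub>m B" using adj_mat(3)[OF A] mult_smult_assoc_mat[OF one_carrier_mat B, of "det A"] B by simp
  finally have "det A \<cdot>\<^sub>m B * A = det A \<cdot>\<^sub>m 1\<^sub>m n" using adj_mat(3)[OF A] by metis
  then have "det A \<cdot>\<^sub>m (B * A) = det A \<cdot>\<^sub>m 1\<^sub>m n" using mult_smult_assoc_mat[OF B A] by simp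
  then have "det A * (B * A) $$ (i, j) = det A * 1\<^sub>m n $$ (i, j)" if "i < n" "j < n" for i j
    using that A B by (metis index_smult_mat(1) index_one_mat(2,3) index_mult_mat(2,3) carrier_matD)
  then show ?thesis using A B d by (intro eq_matI) auto
qed

section \<open>The matrix \<open>D\<close> and the relation \<open>U D U^T = D\<close>\<close>

lemma Dmat_carrier [simp]: "Dmat n \<in> carrier_mat n n"
  by (simp add: Dmat_def)

lemma Dmat_index: "i < n \<Longrightarrow> j < n \<Longrightarrow> Dmat n $$ (i, j) = (if i = j then if i = 0 then - 1 else 1 else 0)"
  by (simp add: Dmat_def mat_diag_def)

lemma Dmat_dim [simp]: "dim_row (Dmat n) = n" "dim_col (Dmat n) = n"
  using Dmat_carrier carrier_matD by blast+

lemma Dmat_mult_carrier [simp]: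
  "A \<in> carrier_mat n m \<Longrightarrow> Dmat n * A \<in> carrier_mat n m"
  "A \<in> carrier_mat m n \<Longrightarrow> A * Dmat n \<in> carrier_mat m n"
  by (auto intro: carrier_matI)

lemma Dmat_mult_self [simp]: "Dmat n * Dmat n = (1\<^sub>m n :: 'a :: comm_ring_1 mat)"
  unfolding Dmat_def mat_diag_diag by (rule eq_matI) (auto simp: mat_diag_def)

lemma index_Dmat_mult:
  fixes A :: "'a :: comm_ring_1 mat"
  assumes "A \<in> carrier_mat n m" "i < n" "j < m"
  shows "(Dmat n * A) $$ (i, j) = flip (\<lambda>k. A $$ (k, j)) i"
  using assms by (simp add: Dmat_def mat_diag_mult_left[of _ n m] flip_def)

lemma index_mult_Dmat:
  fixes A :: "'a :: comm_ring_1 mat"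
  assumes "A \<in> carrier_mat m n" "i < m" "j < n"
  shows "(A * Dmat n) $$ (i, j) = A $$ (i, j) * (if j = 0 then - 1 else 1)"
  using assms by (simp add: Dmat_def mat_diag_mult_right[of _ m n])

lemma index_mult_mat_dot:
  assumes "A \<in> carrier_mat n m" "B \<in> carrier_mat m k" "i < n" "j < k"
  shows "(A * B) $$ (i, j) = dot m (\<lambda>l. A $$ (i, l)) (\<lambda>l. B $$ (l, j))"
  using assms by (simp add: dot_def scalar_prod_def atLeast0LessThan)

text \<open>The row relation says that \<open>D U^T D\<close> is a right inverse of
  \<open>U\<close>; as it is then a left inverse too, the column relation follows. Membership in the
  group is stated for rows, while the degree arguments work with columns.\<close>

lemma form_transpose_iff:
  fixes U :: "'a :: idom mat"
  assumes U: "U \<in> carrier_mat n n"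
  shows "U * Dmat n * transpose_mat U = Dmat n \<longleftrightarrow> transpose_mat U * Dmat n * U = Dmat n"
proof -
  have *: "transpose_mat V * Dmat n * V = Dmat n"
    if V: "V \<in> carrier_mat n n" and eq: "V * Dmat n * transpose_mat V = Dmat n" for V :: "'a mat"
  proof -
    let ?T = "transpose_mat V"
    have T: "?T \<in> carrier_mat n n" using V by simp
    have "V * (Dmat n * ?T * Dmat n) = (V * Dmat n * ?T) * Dmat n"
      using V T carrier_matD[OF V] by (simp add: mat_mult_assoc)
    also have "\<dots> = 1\<^sub>m n" by (simp add: eq)
    finally have "(Dmat n * ?T * Dmat n) * V = 1\<^sub>m n"
      by (intro mat_right_inverse_imp_left[OF V]) (use T in auto)
    then have "Dmat n * ((Dmat n * ?T * Dmat n) * V) = Dmat n" by simp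
    moreover have "Dmat n * ((Dmat n * ?T * Dmat n) * V) = (Dmat n * Dmat n) * (?T * Dmat n * V)"
      using V T carrier_matD[OF V] by (simp add: mat_mult_assoc del: Dmat_mult_self)
    ultimately show ?thesis using V T by simp
  qed
  show ?thesis using *[OF U] *[of "transpose_mat U"] U by auto
qed

text \<open>Multiplying the relation for \<open>U\<close> by \<open>V\<close> from the left and by
  \<open>V^T\<close> from the right cancels \<open>U\<close> and \<open>U^T\<close>.\<close>

lemma form_left_inverse:
  fixes U :: "'a :: comm_ring_1 mat"
  assumes U: "U \<in> carrier_mat n n" and V: "V \<in> carrier_mat n n"
    and eq: "U * Dmat n * transpose_mat U = Dmat n" and VU: "V * U = 1\<^sub>m n"
  shows "V * Dmat n * transpose_mat V = Dmat n"
proof -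
  have 1: "transpose_mat U * transpose_mat V = 1\<^sub>m n"
    using transpose_mult[OF V U] VU by simp
  have "V * (U * Dmat n * transpose_mat U) * transpose_mat V =
      (V * U) * Dmat n * (transpose_mat U * transpose_mat V)"
    using carrier_matD[OF U] carrier_matD[OF V]
    by (simp only: mat_mult_assoc index_mult_mat index_transpose_mat Dmat_dim)
  then show ?thesis
    unfolding eq VU 1 using right_mult_one_mat[of "Dmat n" n n] left_mult_one_mat[of "Dmat n" n n]
    by simp
qed

section \<open>Real matrices and the group they form\<close>

lemma real_mat_coeff_iff:
  "(\<forall>k. real_mat (coeff_mat U k)) \<longleftrightarrow>
    (\<forall>i<dim_row U. \<forall>j<dim_col U. conjugate (U $$ (i, j)) = U $$ (i, j))"
  by (auto simp: real_mat_def poly_eq_iff coeff_conjugate_poly Reals_cnj_iff)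

lemma mat_star_real:
  assumes "\<And>i j. i < dim_row U \<Longrightarrow> j < dim_col U \<Longrightarrow> conjugate (U $$ (i, j)) = U $$ (i, j)"
  shows "mat_star U = transpose_mat U"
  using assms by (intro eq_matI) (auto simp: mat_star_def)

text \<open>Real coefficients mean that the entries are fixed by \<open>conjugate\<close>, so
  \<open>mat_star\<close> becomes the transpose and the argument can be carried out with bilinear
  pairings.\<close>

lemma M_real0_iff:
  "U \<in> M_real0 n \<longleftrightarrow> U \<in> carrier_mat n n \<and>
    (\<forall>i<n. \<forall>j<n. conjugate (U $$ (i, j)) = U $$ (i, j) \<and> poly (U $$ (i, j)) 0 = (if i = j then 1 else 0)) \<and>
    U * Dmat n * transpose_mat U = Dmat n"
proof (cases "U \<in> carrier_mat n n \<and> (\<forall>i<n. \<forall>j<n. conjugate (U $$ (i, j)) = U $$ (i, j))")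
  case True
  then have c: "U \<in> carrier_mat n n" "dim_row U = n" "dim_col U = n"
    and r: "\<forall>i<dim_row U. \<forall>j<dim_col U. conjugate (U $$ (i, j)) = U $$ (i, j)" by auto
  have 1: "map_mat (\<lambda>p. poly p 0) U = 1\<^sub>m n \<longleftrightarrow>
    (\<forall>i<n. \<forall>j<n. poly (U $$ (i, j)) 0 = (if i = j then 1 else 0))"
    unfolding mat_eq_iff using c by simp
  have 2: "mat_star U = transpose_mat U"
    using r by (intro mat_star_real) blast
  have "U \<in> M_real0 n \<longleftrightarrow> U * Dmat n * transpose_mat U = Dmat n \<and> map_mat (\<lambda>p. poly p 0) U = 1\<^sub>m n"
    unfolding M_real0_def M_real_def M_def real_mat_coeff_iff using c(1) r by (simp flip: 2)
  then show ?thesis unfolding 1 using True by blast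
next
  case False
  then show ?thesis
    unfolding M_real0_def M_real_def M_def real_mat_coeff_iff by auto
qed

lemma M_real0_carrier: "U \<in> M_real0 n \<Longrightarrow> U \<in> carrier_mat n n"
  by (simp add: M_real0_iff)

lemma M_real0_at_0: "U \<in> M_real0 n \<Longrightarrow> i < n \<Longrightarrow> j < n \<Longrightarrow> poly (U $$ (i, j)) 0 = (if i = j then 1 else 0)"
  by (simp add: M_real0_iff)

lemma M_real0_conjugate: "U \<in> M_real0 n \<Longrightarrow> i < n \<Longrightarrow> j < n \<Longrightarrow> conjugate (U $$ (i, j)) = U $$ (i, j)"
  by (simp add: M_real0_iff)

lemma M_real0_form: "U \<in> M_real0 n \<Longrightarrow> U * Dmat n * transpose_mat U = Dmat n"
  by (simp add: M_real0_iff)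

lemma conjugate_const_poly: "conjugate [:c:] = ([:conjugate c:] :: complex poly)"
  by (auto simp: poly_eq_iff coeff_conjugate_poly coeff_pCons split: nat.splits)

lemma conjugate_one_poly: "conjugate 1 = (1 :: complex poly)"
  by (simp add: one_pCons conjugate_const_poly)

lemma one_in_M_real0: "1\<^sub>m n \<in> M_real0 n"
  by (auto simp: M_real0_iff conjugate_one_poly)

lemma mult_in_M_real0:
  assumes "U \<in> M_real0 n" "V \<in> M_real0 n"
  shows "U * V \<in> M_real0 n"
proof -
  have U: "U \<in> carrier_mat n n" and V: "V \<in> carrier_mat n n" using assms by (auto simp: M_real0_iff)
  note dims = carrier_matD[OF U] carrier_matD[OF V]
  have e: "(U * V) $$ (i, j) = (\<Sum>k<n. U $$ (i, k) * V $$ (k, j))" if "i < n" "j < n" for i j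
    using index_mult_mat_dot[OF U V that] by (simp add: dot_def)
  have "U * V * Dmat n * transpose_mat (U * V) = U * (V * Dmat n * transpose_mat V) * transpose_mat U"
    using U V dims by (simp add: transpose_mult[of U n n V n] mat_mult_assoc)
  also have "\<dots> = Dmat n" using assms by (simp add: M_real0_iff)
  finally have "U * V * Dmat n * transpose_mat (U * V) = Dmat n" .
  moreover have "conjugate ((U * V) $$ (i, j)) = (U * V) $$ (i, j)" if "i < n" "j < n" for i j
    using assms that by (simp add: e sum_conjugate conjugate_dist_mul M_real0_conjugate)
  moreover have "poly ((U * V) $$ (i, j)) 0 = (if i = j then 1 else 0)" if "i < n" "j < n" for i j
  proof -
    have "poly ((U * V) $$ (i, j)) 0 = (\<Sum>k<n. (if i = k then 1 else 0) * (if k = j then 1 else 0))"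
      unfolding e[OF that] poly_sum poly_mult using that assms by (intro sum.cong) (auto simp: M_real0_at_0)
    also have "\<dots> = (\<Sum>k<n. if k = j then if i = j then 1 else 0 else 0)"
      by (rule sum.cong) auto
    finally show ?thesis using that by simp
  qed
  ultimately show ?thesis unfolding M_real0_iff using U V by (auto simp del: index_mult_mat)
qed

lemma inverse_in_M_real0:
  assumes U: "U \<in> M_real0 n"
  shows "\<exists>V\<in>M_real0 n. V * U = 1\<^sub>m n"
proof
  \<comment> \<open>\<open>D U^T D\<close> inverts \<open>U\<close> by the column relation
    \<open>U^T D U = D\<close>, and it is the identity at 0 because \<open>D D = 1\<close>.\<close>
  let ?T = "transpose_mat U" and ?V = "Dmat n * transpose_mat U * Dmat n"
  have c: "U \<in> carrier_mat n n" "?T \<in> carrier_mat n n" "dim_row U = n" "dim_col U = n"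
    using U by (auto simp: M_real0_iff)
  have T: "?T * Dmat n * U = Dmat n" using U c form_transpose_iff by (auto simp: M_real0_iff)
  have "?V * U = Dmat n * (?T * Dmat n * U)"
    using c by (simp add: mat_mult_assoc)
  then show VU: "?V * U = 1\<^sub>m n" using T by simp
  have V: "?V \<in> carrier_mat n n" using c by simp
  have form: "?V * Dmat n * transpose_mat ?V = Dmat n"
    by (rule form_left_inverse[OF c(1) V M_real0_form[OF U] VU])
  have e: "?V $$ (i, j) = (if i = 0 then - 1 else 1) * U $$ (j, i) * (if j = 0 then - 1 else 1)"
    if "i < n" "j < n" for i j
  proof -
    have "?V $$ (i, j) = (Dmat n * ?T) $$ (i, j) * (if j = 0 then - 1 else 1)"
      by (rule index_mult_Dmat[of _ n]) (use that c in auto)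
    also have "(Dmat n * ?T) $$ (i, j) = flip (\<lambda>k. ?T $$ (k, j)) i"
      by (rule index_Dmat_mult[of _ n n]) (use that c in auto)
    finally show ?thesis using that c(3,4) by (simp only: flip_def index_transpose_mat) simp
  qed
  have "conjugate (?V $$ (i, j)) = ?V $$ (i, j) \<and> poly (?V $$ (i, j)) 0 = (if i = j then 1 else 0)"
    if "i < n" "j < n" for i j
    using M_real0_conjugate[OF U that(2,1)] M_real0_at_0[OF U that(2,1)]
    unfolding e[OF that] by (auto simp: conjugate_neg)
  then show "?V \<in> M_real0 n" using V form unfolding M_real0_iff by blast
qed

lemma group_M_real0: "group (M_real0_group n)"
proof (rule groupI)
  fix U assume "U \<in> carrier (M_real0_group n)"
  then show "\<exists>V\<in>carrier (M_real0_group n). V \<otimes>\<^bsub>M_real0_group n\<^esub> U = \<one>\<^bsub>M_real0_group n\<^esub>"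
    using inverse_in_M_real0 by (simp add: M_def)
qed (auto simp: M_def one_in_M_real0 mult_in_M_real0 dest!: M_real0_carrier intro!: assoc_mult_mat)

text \<open>This is the column relation entry by entry. Since the right-hand side is constant,
  coefficients of positive degree in the pairings vanish, and on this the degree reduction
  rests.\<close>

lemma M_real0_columns:
  assumes "U \<in> M_real0 n" "i < n" "j < n"
  shows "dot n (\<lambda>k. U $$ (k, i)) (flip (\<lambda>k. U $$ (k, j))) = Dmat n $$ (i, j)"
proof -
  have c: "U \<in> carrier_mat n n" "dim_row U = n" "dim_col U = n" using assms by (auto simp: M_real0_iff)
  have "(transpose_mat U * (Dmat n * U)) $$ (i, j) = Dmat n $$ (i, j)"
    using assms c form_transpose_iff[OF c(1)] by (simp add: M_real0_iff mat_mult_assoc)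
  moreover have "(transpose_mat U * (Dmat n * U)) $$ (i, j) = dot n (\<lambda>k. U $$ (k, i)) (flip (\<lambda>k. U $$ (k, j)))"
    using assms c by (subst index_mult_mat_dot[of _ n n _ n])
      (auto simp: index_Dmat_mult[of _ n n] intro!: dot_cong simp del: index_mult_mat)
  ultimately show ?thesis by simp
qed

section \<open>The subgroups indexed by isotropic directions\<close>

abbreviation cvec :: "complex vec \<Rightarrow> nat \<Rightarrow> complex poly"
  where "cvec z \<equiv> \<lambda>i. [:z $ i:]"

lemma index_Dmat_mult_vec:
  fixes z :: "'a :: comm_ring_1 vec"
  assumes "z \<in> carrier_vec n" "i < n"
  shows "(Dmat n *\<^sub>v z) $ i = flip (\<lambda>i. z $ i) i"
proof -
  have "(Dmat n *\<^sub>v z) $ i = (\<Sum>k<n. Dmat n $$ (i, k) * z $ k)"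
    using assms by (simp add: scalar_prod_def atLeast0LessThan)
  also have "\<dots> = (\<Sum>k<n. if k = i then flip (\<lambda>i. z $ i) i else 0)"
    using assms(2) by (intro sum.cong) (auto simp: Dmat_index flip_def)
  finally show ?thesis using assms(2) by simp
qed

lemma Xi_real_iff:
  assumes "0 < n"
  shows "z \<in> Xi_real n \<longleftrightarrow> z \<in> carrier_vec n \<and> (\<forall>i<n. cnj (z $ i) = z $ i) \<and> z $ 0 = 1 \<and>
    dot n (\<lambda>i. z $ i) (flip (\<lambda>i. z $ i)) = 0"
proof (cases "z \<in> carrier_vec n \<and> (\<forall>i<n. cnj (z $ i) = z $ i)")
  case True
  have "(Dmat n *\<^sub>v z) \<bullet>c z = dot n (flip (\<lambda>i. z $ i)) (\<lambda>i. z $ i)"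
    using True by (auto simp: scalar_prod_def dot_def atLeast0LessThan index_Dmat_mult_vec
      simp del: index_mult_mat_vec intro!: sum.cong)
  then show ?thesis using True
    by (auto simp: Xi_real_def real_vec_def Reals_cnj_iff dot_flip_left)
qed (auto simp: Xi_real_def real_vec_def Reals_cnj_iff)

lemma dot_const: "dot n (\<lambda>i. [:f i:]) (\<lambda>i. [:g i:]) = [:dot n f g:]"
  by (simp add: dot_def sum_to_poly mult.commute)

lemma flip_const: "flip (\<lambda>i. [:f i:]) = (\<lambda>i. [:flip f i:])"
  by (auto simp: flip_def)

lemma coeff_dot_const: "coeff (dot n (\<lambda>i. [:f i:]) g) k = dot n f (\<lambda>i. coeff (g i) k)"
  by (simp add: dot_def coeff_sum)

lemma dot_const_isotropic:
  assumes "z \<in> Xi_real n" "0 < n"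
  shows "dot n (cvec z) (flip (cvec z)) = 0"
  using assms by (simp add: flip_const dot_const Xi_real_iff)

text \<open>Since \<open>z $ 0 = 1\<close>, the pairings of \<open>g\<close> with \<open>z\<close>
  and with \<open>D z\<close> differ by \<open>2 * g $ 0\<close>, so together they say
  \<open>z^T g = 0\<close> and \<open>g $ 0 = 0\<close>. The latter means
  \<open>D g = g\<close>.\<close>

lemma Delta_real_iff:
  assumes n: "0 < n" and z: "z \<in> Xi_real n"
  shows "g \<in> Delta_real n z \<longleftrightarrow> g \<in> carrier_vec n \<and> (\<forall>i<n. conjugate (g $ i) = g $ i \<and> poly (g $ i) 0 = 0) \<and>
    dot n (cvec z) (\<lambda>i. g $ i) = 0 \<and> g $ 0 = 0"
proof (cases "g \<in> carrier_vec n \<and> (\<forall>i<n. conjugate (g $ i) = g $ i)")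
  case True
  have Z: "z \<in> carrier_vec n" "z $ 0 = 1" using z n by (auto simp: Xi_real_iff)
  have c: "cnj (coeff (g $ i) k) = coeff (g $ i) k" if "i < n" for i k
    using True that by (metis coeff_conjugate_poly conjugate_complex_def)
  note d = index_Dmat_mult_vec[OF Z(1)]
  have 1: "z \<bullet>c coeff_vec g k = coeff (dot n (cvec z) (\<lambda>i. g $ i)) k" for k
    using True c unfolding coeff_dot_const
    by (auto simp: scalar_prod_def dot_def atLeast0LessThan intro!: sum.cong)
  have "(Dmat n *\<^sub>v z) \<bullet>c coeff_vec g k = dot n (flip (\<lambda>i. z $ i)) (\<lambda>i. coeff (g $ i) k)" for k
    using True c d by (auto simp: scalar_prod_def dot_def atLeast0LessThan simp del: index_mult_mat_vec intro!: sum.cong)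
  also have "dot n (flip (\<lambda>i. z $ i)) (\<lambda>i. coeff (g $ i) k) =
      dot n (\<lambda>i. z $ i) (\<lambda>i. coeff (g $ i) k) - 2 * coeff (g $ 0) k" for k
    using n Z(2) unfolding dot_def by (cases n) (simp_all add: flip_def lessThan_Suc_eq_insert_0 sum.reindex)
  finally have 2: "(Dmat n *\<^sub>v z) \<bullet>c coeff_vec g k = coeff (dot n (cvec z) (\<lambda>i. g $ i)) k - 2 * coeff (g $ 0) k" for k
    unfolding coeff_dot_const .
  have 3: "coeff_vec g 0 = 0\<^sub>v n \<longleftrightarrow> (\<forall>i<n. poly (g $ i) 0 = 0)"
    using True by (auto simp: vec_eq_iff poly_0_coeff_0)
  have 4: "real_vec (coeff_vec g k)" for k
    using True c by (auto simp: real_vec_def Reals_cnj_iff)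
  have 5: "(\<forall>k. coeff d k = 0 \<and> coeff d k - 2 * coeff p k = 0) \<longleftrightarrow> d = 0 \<and> p = 0" for d p :: "complex poly"
    by (simp add: poly_eq_iff all_conj_distrib cong: conj_cong)
  have 6: "g \<in> Delta_real n z \<longleftrightarrow> g \<in> carrier_vec n \<and> (\<forall>i<n. poly (g $ i) 0 = 0) \<and>
      dot n (cvec z) (\<lambda>i. g $ i) = 0 \<and> g $ 0 = 0"
    unfolding Delta_real_def mem_Collect_eq 1 2 3 by (simp only: 4 5 simp_thms)
  show ?thesis unfolding 6 using True by auto
qed (auto simp: Delta_real_def real_vec_def Reals_cnj_iff poly_eq_iff coeff_conjugate_poly)

text \<open>Real coefficients give \<open>conjugate \<phi> = \<phi>\<close>, so every coefficient
  equals its own negative.\<close>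

lemma Phi_real_eq: "Phi_real = {0}"
proof -
  have "\<phi> = 0" if "\<phi> \<in> Phi_real" for \<phi>
  proof -
    have "coeff \<phi> k = - coeff \<phi> k" for k
      using that by (auto simp: Phi_real_def poly_eq_iff coeff_conjugate_poly Reals_cnj_iff)
    then show ?thesis by (simp add: poly_eq_iff)
  qed
  moreover have "0 \<in> Phi_real" by (simp add: Phi_real_def)
  ultimately show ?thesis by auto
qed

lemma M_real_at_eq: "M_real_at n z = G_mat n z 0 ` Delta_real n z"
  by (auto simp: M_real_at_def Phi_real_eq)

lemma G_mat_carrier [simp]: "G_mat n z \<phi> g \<in> carrier_mat n n"
  by (simp add: G_mat_def Let_def)

lemma G_mat_index:
  assumes "0 < n" and z: "z \<in> Xi_real n" and g: "g \<in> Delta_real n z" and ij: "i < n" "j < n"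
  shows "G_mat n z 0 g $$ (i, j) = (if i = j then 1 else 0) +
    (((g $ j) - half * dot n (\<lambda>k. g $ k) (\<lambda>k. g $ k) * [:z $ j:]) * flip (cvec z) i - [:z $ j:] * g $ i)"
proof -
  let ?zp = "const_vec z"
  have Z: "z \<in> carrier_vec n" "\<And>i. i < n \<Longrightarrow> cnj (z $ i) = z $ i" using z \<open>0 < n\<close> by (auto simp: Xi_real_iff)
  have G: "g \<in> carrier_vec n" "\<And>i. i < n \<Longrightarrow> conjugate (g $ i) = g $ i" "g $ 0 = 0"
    using g z \<open>0 < n\<close> by (auto simp: Delta_real_iff)
  have q: "g \<bullet>c g = dot n (\<lambda>k. g $ k) (\<lambda>k. g $ k)"
    using G by (auto simp: scalar_prod_def dot_def atLeast0LessThan intro!: sum.cong)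
  let ?K = "(0 - Polynomial.smult (1/2) (g \<bullet>c g)) \<cdot>\<^sub>m outer ?zp ?zp + (outer ?zp g - outer g ?zp)"
  have K: "?K \<in> carrier_mat n n" using Z G by (auto simp: outer_def)
  have Kij: "?K $$ (k, j) = - half * dot n (\<lambda>k. g $ k) (\<lambda>k. g $ k) * ([:z $ k:] * [:z $ j:]) + ([:z $ k:] * g $ j - g $ k * [:z $ j:])"
    if "k < n" for k
    using Z G ij that by (simp add: outer_def q conjugate_const_poly mult.commute)
  have "G_mat n z 0 g $$ (i, j) = (Dmat n * ?K) $$ (i, j) + (if i = j then 1 else 0)"
    using ij K by (simp add: G_mat_def Let_def del: index_mult_mat)
  also have "(Dmat n * ?K) $$ (i, j) = flip (\<lambda>k. ?K $$ (k, j)) i"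
    by (rule index_Dmat_mult[OF K ij])
  also have "\<dots> = ((g $ j) - half * dot n (\<lambda>k. g $ k) (\<lambda>k. g $ k) * [:z $ j:]) * flip (cvec z) i - [:z $ j:] * g $ i"
    unfolding flip_def using Kij[OF ij(1)] G(3) by (auto simp: algebra_simps)
  finally show ?thesis by simp
qed

text \<open>The bridge from matrices to \<open>eichler\<close>: row \<open>i\<close> of the matrix
  is a combination of a unit vector, \<open>g\<close> and \<open>z\<close>, and it is paired with
  column \<open>j\<close> of \<open>U\<close> term by term.\<close>

lemma index_G_mat_mult:
  assumes n: "0 < n" and z: "z \<in> Xi_real n" and g: "g \<in> Delta_real n z"
    and U: "U \<in> carrier_mat n n" and ij: "i < n" "j < n"
  shows "(G_mat n z 0 g * U) $$ (i, j) = eichler n (cvec z) (\<lambda>k. g $ k) (\<lambda>k. U $$ (k, j)) i"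
proof -
  define q where "q = half * dot n (\<lambda>k. g $ k) (\<lambda>k. g $ k)"
  have fg: "flip (\<lambda>k. g $ k) i = g $ i"
    using g z n by (auto simp: flip_def Delta_real_iff)
  let ?u = "\<lambda>k. U $$ (k, j)" and ?a = "flip (cvec z) i"
  have "(G_mat n z 0 g * U) $$ (i, j) = dot n (\<lambda>k. G_mat n z 0 g $$ (i, k)) ?u"
    by (rule index_mult_mat_dot) (use U ij in auto)
  also have "\<dots> = dot n (\<lambda>k. (if k = i then 1 else 0) + (?a * g $ k - (q * ?a + g $ i) * [:z $ k:])) ?u"
    using ij(1) by (intro dot_cong) (auto simp: G_mat_index[OF n z g] q_def algebra_simps)
  also have "\<dots> = ?u i + (?a * dot n (\<lambda>k. g $ k) ?u - (q * ?a + g $ i) * dot n (cvec z) ?u)"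
    by (simp only: dot_linear dot_commute[of n "\<lambda>k. if k = i then 1 else 0"] dot_unit[OF ij(1)])
  also have "\<dots> = eichler n (cvec z) (\<lambda>k. g $ k) ?u i"
    unfolding eichler_def fg q_def by (simp only: algebra_simps)
  finally show ?thesis .
qed

lemma G_mat_eichler:
  assumes "0 < n" "z \<in> Xi_real n" "g \<in> Delta_real n z" "i < n" "j < n"
  shows "G_mat n z 0 g $$ (i, j) = eichler n (cvec z) (\<lambda>k. g $ k) (\<lambda>k. if k = j then 1 else 0) i"
  using index_G_mat_mult[OF assms(1-3) one_carrier_mat assms(4,5)] assms(4,5)
    right_mult_one_mat[OF G_mat_carrier] by (simp cong: eichler_cong)

section \<open>The subgroups as images of the additive groups \<open>Delta_real n z\<close>\<close>

lemma Delta_real_add: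
  assumes "0 < n" "z \<in> Xi_real n" "g \<in> Delta_real n z" "h \<in> Delta_real n z"
  shows "g + h \<in> Delta_real n z"
proof -
  have "dot n (cvec z) (\<lambda>i. (g + h) $ i) = dot n (cvec z) (\<lambda>i. g $ i + h $ i)"
    using assms by (intro dot_cong) (auto simp: Delta_real_iff)
  then show ?thesis
    using assms by (auto simp: Delta_real_iff conjugate_dist_add dot_linear)
qed

lemma Delta_real_uminus:
  assumes "0 < n" "z \<in> Xi_real n" "g \<in> Delta_real n z"
  shows "- g \<in> Delta_real n z"
proof -
  have "dot n (cvec z) (\<lambda>i. (- g) $ i) = dot n (cvec z) (\<lambda>i. (- 1) * g $ i)"
    using assms by (intro dot_cong) (auto simp: Delta_real_iff)
  also have "\<dots> = (- 1) * dot n (cvec z) (\<lambda>i. g $ i)"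
    by (rule dot_linear(3))
  finally show ?thesis
    using assms by (auto simp: Delta_real_iff conjugate_neg)
qed

lemma Delta_real_zero:
  assumes "0 < n" "z \<in> Xi_real n"
  shows "0\<^sub>v n \<in> Delta_real n z"
  using assms by (auto simp: Delta_real_iff dot_def)

lemma Delta_real_eichler:
  assumes "0 < n" "z \<in> Xi_real n" "g \<in> Delta_real n z"
  shows "dot n (cvec z) (flip (cvec z)) = 0" "dot n (cvec z) (\<lambda>i. g $ i) = 0"
    "flip (\<lambda>i. g $ i) = (\<lambda>i. g $ i)"
  using assms by (auto simp: Delta_real_iff dot_const_isotropic flip_def)

text \<open>Both sides are compared on unit vectors, where \<open>eichler_eichler\<close> applies.
  As the image of a commutative group under this homomorphism, \<open>M_real_at n z\<close> is
  commutative.\<close>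

lemma G_mat_add:
  assumes "0 < n" "z \<in> Xi_real n" "g \<in> Delta_real n z" "h \<in> Delta_real n z"
  shows "G_mat n z 0 g * G_mat n z 0 h = G_mat n z 0 (g + h)"
proof (rule eq_matI)
  fix i j assume "i < dim_row (G_mat n z 0 (g + h))" "j < dim_col (G_mat n z 0 (g + h))"
  then have ij: "i < n" "j < n" by (simp_all add: carrier_matD[OF G_mat_carrier])
  let ?e = "\<lambda>k. if k = j then 1 else 0" and ?g = "\<lambda>k. g $ k" and ?h = "\<lambda>k. h $ k"
  have "(G_mat n z 0 g * G_mat n z 0 h) $$ (i, j) = eichler n (cvec z) ?g (eichler n (cvec z) ?h ?e) i"
    unfolding index_G_mat_mult[OF assms(1-3) G_mat_carrier ij]
    using ij by (intro eichler_cong) (auto simp: G_mat_eichler assms)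
  also have "\<dots> = eichler n (cvec z) (\<lambda>k. g $ k + h $ k) ?e i"
    by (intro fun_cong[OF eichler_eichler])
      (use Delta_real_eichler[OF assms(1,2)] assms in auto)
  also have "\<dots> = eichler n (cvec z) (\<lambda>k. (g + h) $ k) ?e i"
    using assms ij by (intro eichler_cong) (auto simp: Delta_real_iff)
  also have "\<dots> = G_mat n z 0 (g + h) $$ (i, j)"
    by (rule G_mat_eichler[OF assms(1,2) Delta_real_add[OF assms] ij, symmetric])
  finally show "(G_mat n z 0 g * G_mat n z 0 h) $$ (i, j) = G_mat n z 0 (g + h) $$ (i, j)" .
qed (simp_all add: carrier_matD[OF G_mat_carrier])

lemma G_mat_zero:
  assumes "0 < n" "z \<in> Xi_real n"
  shows "G_mat n z 0 (0\<^sub>v n) = 1\<^sub>m n"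
  using assms Delta_real_zero[OF assms]
  by (intro eq_matI) (auto simp: G_mat_eichler eichler_zero carrier_matD[OF G_mat_carrier])

lemma G_mat_in_M_real0:
  assumes n: "0 < n" and z: "z \<in> Xi_real n" and g: "g \<in> Delta_real n z"
  shows "G_mat n z 0 g \<in> M_real0 n"
proof -
  let ?G = "G_mat n z 0 g" and ?e = "\<lambda>j k. if k = j then 1 else 0"
  have Z: "\<And>i. i < n \<Longrightarrow> cnj (z $ i) = z $ i" using z n by (auto simp: Xi_real_iff)
  have G: "\<And>i. i < n \<Longrightarrow> conjugate (g $ i) = g $ i \<and> poly (g $ i) 0 = 0"
    using g z n by (auto simp: Delta_real_iff)
  have dims: "dim_row ?G = n" "dim_col ?G = n" using carrier_matD[OF G_mat_carrier] by auto
  \<comment> \<open>The columns of \<open>?G\<close> are the images of the unit vectors under an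
    isometry, which gives the column relation; \<open>form_transpose_iff\<close> turns it into the
    row relation.\<close>
  have "transpose_mat ?G * (Dmat n * ?G) = Dmat n"
  proof (rule eq_matI)
    fix i j assume "i < dim_row (Dmat n :: complex poly mat)" "j < dim_col (Dmat n :: complex poly mat)"
    then have ij: "i < n" "j < n" by auto
    have "(transpose_mat ?G * (Dmat n * ?G)) $$ (i, j) = dot n (\<lambda>k. ?G $$ (k, i)) (flip (\<lambda>k. ?G $$ (k, j)))"
      using ij dims by (subst index_mult_mat_dot[of _ n n _ n])
        (auto simp: index_Dmat_mult[of _ n n] intro!: dot_cong simp del: index_mult_mat)
    also have "\<dots> = dot n (eichler n (cvec z) (\<lambda>k. g $ k) (?e i)) (flip (eichler n (cvec z) (\<lambda>k. g $ k) (?e j)))"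
      using ij by (intro dot_cong) (auto simp: flip_def G_mat_eichler[OF n z g])
    also have "\<dots> = dot n (?e i) (flip (?e j))"
      by (rule eichler_isometry) (use Delta_real_eichler[OF n z g] in auto)
    also have "\<dots> = flip (?e j) i"
      by (simp add: dot_commute[of n "?e i"] dot_unit[OF ij(1)])
    finally show "(transpose_mat ?G * (Dmat n * ?G)) $$ (i, j) = Dmat n $$ (i, j)"
      using ij by (simp add: Dmat_index flip_def)
  qed (simp_all add: dims)
  then have "transpose_mat ?G * Dmat n * ?G = Dmat n"
    by (simp add: mat_mult_assoc dims)
  then have form: "?G * Dmat n * transpose_mat ?G = Dmat n"
    using form_transpose_iff[OF G_mat_carrier] by blast
  have q: "conjugate (dot n (\<lambda>k. g $ k) (\<lambda>k. g $ k)) = dot n (\<lambda>k. g $ k) (\<lambda>k. g $ k)"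
    by (simp add: dot_def sum_conjugate conjugate_dist_mul G)
  have q0: "poly (dot n (\<lambda>k. g $ k) (\<lambda>k. g $ k)) 0 = 0"
    by (simp add: dot_def poly_sum G)
  have "conjugate (?G $$ (i, j)) = ?G $$ (i, j)" if "i < n" "j < n" for i j
    using that unfolding G_mat_index[OF n z g that]
    by (simp add: conjugate_dist_mul conjugate_dist_add conjugate_neg diff_conv_add_uminus q flip_def
      conjugate_const_poly conjugate_one_poly Z G del: mult_pCons_left mult_pCons_right add_uminus_conv_diff)
  moreover have "poly (?G $$ (i, j)) 0 = (if i = j then 1 else 0)" if "i < n" "j < n" for i j
    using that unfolding G_mat_index[OF n z g that] by (simp add: q0 G)
  ultimately have "\<forall>i<n. \<forall>j<n. conjugate (?G $$ (i, j)) = ?G $$ (i, j) \<and> poly (?G $$ (i, j)) 0 = (if i = j then 1 else 0)"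
    by blast
  then show ?thesis unfolding M_real0_iff using form G_mat_carrier[of n z 0 g] by (intro conjI)
qed

lemma subgroup_M_real_at:
  assumes n: "0 < n" and z: "z \<in> Xi_real n"
  shows "subgroup (M_real_at n z) (M_real0_group n)"
proof -
  interpret group "M_real0_group n" by (rule group_M_real0)
  have sub: "M_real_at n z \<subseteq> carrier (M_real0_group n)"
    using G_mat_in_M_real0[OF n z] by (auto simp: M_real_at_eq)
  have mult: "x * y \<in> M_real_at n z" if "x \<in> M_real_at n z" "y \<in> M_real_at n z" for x y
    using that G_mat_add[OF n z] Delta_real_add[OF n z] by (auto simp: M_real_at_eq)
  have inv: "\<exists>y\<in>M_real_at n z. y * x = 1\<^sub>m n" if x: "x \<in> M_real_at n z" for x
  proof -
    obtain g where g: "g \<in> Delta_real n z" "x = G_mat n z 0 g" using x by (auto simp: M_real_at_eq)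
    have "G_mat n z 0 (- g) * x = G_mat n z 0 (- g + g)"
      using g G_mat_add[OF n z Delta_real_uminus[OF n z]] by simp
    also have "- g + g = 0\<^sub>v n" using g(1) n z by (auto simp: Delta_real_iff)
    finally show ?thesis
      using G_mat_zero[OF n z] Delta_real_uminus[OF n z g(1)] by (auto simp: M_real_at_eq)
  qed
  show ?thesis
  proof (rule subgroupI)
    fix x assume x: "x \<in> M_real_at n z"
    then obtain y where y: "y \<in> M_real_at n z" "y * x = 1\<^sub>m n" using inv by blast
    then have "inv\<^bsub>M_real0_group n\<^esub> x = y"
      using x sub by (intro inv_equality) (auto simp: M_def)
    then show "inv\<^bsub>M_real0_group n\<^esub> x \<in> M_real_at n z" using y by simp
  qed (use sub mult Delta_real_zero[OF n z] in \<open>auto simp: M_def M_real_at_eq\<close>)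
qed

lemma comm_group_M_real_at:
  assumes n: "0 < n" and z: "z \<in> Xi_real n"
  shows "comm_group ((M_real0_group n)\<lparr>carrier := M_real_at n z\<rparr>)"
proof -
  interpret group "(M_real0_group n)\<lparr>carrier := M_real_at n z\<rparr>"
    using subgroup.subgroup_is_group[OF subgroup_M_real_at[OF n z] group_M_real0] .
  have "G_mat n z 0 g * G_mat n z 0 h = G_mat n z 0 h * G_mat n z 0 g"
    if "g \<in> Delta_real n z" "h \<in> Delta_real n z" for g h
  proof -
    have "g + h = h + g" using that n z by (intro comm_add_vec[of _ n]) (auto simp: Delta_real_iff)
    then show ?thesis using that G_mat_add[OF n z] by simp
  qed
  then show ?thesis
    by (intro group_comm_groupI) (auto simp: M_def M_real_at_eq)
qed

section \<open>Leading coefficients\<close>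

text \<open>In any other term of the convolution one index exceeds its bound. The bounds
  \<open>a\<close> and \<open>b\<close> need not be attained, so the right-hand side may be
  zero.\<close>

lemma coeff_mult_top:
  fixes p q :: "'a :: comm_semiring_0 poly"
  assumes "degree p \<le> a" "degree q \<le> b"
  shows "coeff (p * q) (a + b) = coeff p a * coeff q b"
proof -
  have "coeff (p * q) (a + b) = (\<Sum>i\<le>a + b. if i = a then coeff p a * coeff q b else 0)"
    unfolding coeff_mult
  proof (rule sum.cong)
    fix i assume "i \<in> {..a + b}"
    then have "i < a \<and> b < a + b - i \<or> i = a \<or> a < i" by auto
    then show "coeff p i * coeff q (a + b - i) = (if i = a then coeff p a * coeff q b else 0)"
      using assms by (auto simp: coeff_eq_0)
  qed simp
  then show ?thesis by simp
qed

lemma degree_mult_bound: "degree p \<le> a \<Longrightarrow> degree q \<le> b \<Longrightarrow> degree (p * q) \<le> a + b"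
  using degree_mult_le[of p q] by linarith

lemma degree_dot_le:
  assumes "\<And>i. i < n \<Longrightarrow> degree (f i) \<le> a" "\<And>i. i < n \<Longrightarrow> degree (g i) \<le> b"
  shows "degree (dot n f g) \<le> a + b"
  unfolding dot_def by (intro degree_sum_le) (auto intro: degree_mult_bound assms)

lemma coeff_dot_top:
  assumes "\<And>i. i < n \<Longrightarrow> degree (f i) \<le> a" "\<And>i. i < n \<Longrightarrow> degree (g i) \<le> b"
  shows "coeff (dot n f g) (a + b) = dot n (\<lambda>i. coeff (f i) a) (\<lambda>i. coeff (g i) b)"
  unfolding dot_def coeff_sum by (intro sum.cong refl coeff_mult_top) (use assms in auto)

lemma coeff_flip: "coeff (flip f i) k = flip (\<lambda>i. coeff (f i) k) i"
  by (simp add: flip_def)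

lemma degree_flip [simp]: "degree (flip f i) = degree (f i)"
  by (simp add: flip_def)

text \<open>For real entries the pairing is a sum of squares.\<close>

lemma dot_self_eq_0:
  assumes "\<And>i. i < n \<Longrightarrow> cnj (a i) = a i" "dot n a a = 0" "i < n"
  shows "a i = 0"
proof -
  have a: "a i = of_real (Re (a i))" if "i < n" for i
    using assms(1)[OF that] by (simp add: complex_eq_iff)
  then have "dot n a a = of_real (\<Sum>i<n. (Re (a i))\<^sup>2)"
    unfolding dot_def of_real_sum
    by (intro sum.cong refl) (metis lessThan_iff of_real_mult power2_eq_square)
  then have "(\<Sum>i<n. (Re (a i))\<^sup>2) = 0" using assms(2) by (metis of_real_eq_0_iff)
  then have "Re (a i) = 0" using assms(3) by (simp add: sum_nonneg_eq_0_iff)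
  then show ?thesis using a[OF assms(3)] by simp
qed

text \<open>On the hyperplane where coordinate 0 vanishes \<open>D\<close> is the identity, so the
  form is positive definite there. Orthogonal isotropic vectors are shown to be proportional by
  cancelling coordinate 0 and applying this.\<close>

lemma isotropic_eq_0:
  assumes "\<And>i. i < n \<Longrightarrow> cnj (a i) = a i" "dot n a (flip a) = 0" "a 0 = 0" "i < n"
  shows "a i = 0"
proof (rule dot_self_eq_0[OF assms(1) _ assms(4)])
  have "flip a = a" using assms(3) by (auto simp: flip_def)
  then show "dot n a a = 0" using assms(2) by simp
qed

text \<open>The difference \<open>z - w\<close> is isotropic because \<open>z\<close> and
  \<open>w\<close> are isotropic and orthogonal, and its coordinate 0 is
  \<open>1 - 1\<close>.\<close>

lemma Xi_real_nonorthogonal: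
  assumes n: "0 < n" and z: "z \<in> Xi_real n" and w: "w \<in> Xi_real n"
    and 0: "dot n (\<lambda>i. z $ i) (flip (\<lambda>i. w $ i)) = 0"
  shows "z = w"
proof -
  let ?f = "\<lambda>i. z $ i - w $ i"
  have "dot n (\<lambda>i. w $ i) (flip (\<lambda>i. z $ i)) = 0"
    using 0 dot_flip_left[of n "\<lambda>i. z $ i" "\<lambda>i. w $ i"]
      dot_commute[of n "\<lambda>i. w $ i" "flip (\<lambda>i. z $ i)"] by simp
  then have f0: "dot n ?f (flip ?f) = 0"
    using z w n 0 by (simp add: dot_linear flip_linear Xi_real_iff)
  have "?f i = 0" if "i < n" for i
    by (rule isotropic_eq_0[of n ?f, OF _ f0]) (use that z w n in \<open>auto simp: Xi_real_iff\<close>)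
  then show ?thesis using z w n by (intro eq_vecI) (auto simp: Xi_real_iff)
qed

section \<open>Leading coefficients of reduced words\<close>

text \<open>The leading coefficient of \<open>U\<close> is \<open>(D z) b^T\<close> with
  \<open>b\<close> nonzero, in positive degree. This is the invariant from which the first index of
  a reduced word is read off.\<close>

definition leads :: "nat \<Rightarrow> complex vec \<Rightarrow> complex poly mat \<Rightarrow> bool"
  where "leads n z U \<longleftrightarrow> (\<exists>d>0. \<exists>b. (\<forall>i<n. \<forall>j<n. degree (U $$ (i, j)) \<le> d \<and>
    coeff (U $$ (i, j)) d = b j * flip (\<lambda>i. z $ i) i) \<and> (\<exists>j<n. b j \<noteq> 0))"

text \<open>Coordinate 0 of both \<open>D z\<close> and \<open>D w\<close> is -1, so row 0 of
  \<open>U\<close> determines first the degree and then the vector \<open>b\<close>; a column with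
  \<open>b j \<noteq> 0\<close> gives back \<open>D z\<close>.\<close>

lemma leads_unique:
  assumes n: "0 < n" and z: "z \<in> Xi_real n" and w: "w \<in> Xi_real n" and "leads n z U" "leads n w U"
  shows "z = w"
proof -
  obtain d b j where d: "\<And>i j. i < n \<Longrightarrow> j < n \<Longrightarrow> degree (U $$ (i, j)) \<le> d"
      "\<And>i j. i < n \<Longrightarrow> j < n \<Longrightarrow> coeff (U $$ (i, j)) d = b j * flip (\<lambda>i. z $ i) i" and j: "j < n" "b j \<noteq> 0"
    using \<open>leads n z U\<close> unfolding leads_def by blast
  obtain e c k where e: "\<And>i j. i < n \<Longrightarrow> j < n \<Longrightarrow> degree (U $$ (i, j)) \<le> e"
      "\<And>i j. i < n \<Longrightarrow> j < n \<Longrightarrow> coeff (U $$ (i, j)) e = c j * flip (\<lambda>i. w $ i) i" and k: "k < n" "c k \<noteq> 0"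
    using \<open>leads n w U\<close> unfolding leads_def by blast
  have 0: "flip (\<lambda>i. z $ i) 0 = - 1" "flip (\<lambda>i. w $ i) 0 = - 1"
    using z w n by (auto simp: flip_def Xi_real_iff)
  have "d \<le> degree (U $$ (0, j))" using d(2)[OF n j(1)] j 0 by (intro le_degree) simp
  also have "\<dots> \<le> e" using e n j by blast
  finally have "d \<le> e" .
  have "e \<le> degree (U $$ (0, k))" using e(2)[OF n k(1)] k 0 by (intro le_degree) simp
  also have "\<dots> \<le> d" using d n k by blast
  finally have "d = e" using \<open>d \<le> e\<close> by simp
  then have "b j = c j" using d(2)[OF n j(1)] e(2)[OF n j(1)] 0 by simp
  then have "flip (\<lambda>i. z $ i) i = flip (\<lambda>i. w $ i) i" if "i < n" for i
    using d(2)[OF that j(1)] e(2)[OF that j(1)] j \<open>d = e\<close> by simp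
  then have "z $ i = w $ i" if "i < n" for i
    using that by (metis flip_flip flip_def neg_equal_iff_equal)
  then show ?thesis using z w n by (intro eq_vecI) (auto simp: Xi_real_iff)
qed

lemma not_leads_one:
  assumes n: "0 < n" and z: "z \<in> Xi_real n"
  shows "\<not> leads n z (1\<^sub>m n)"
proof
  assume "leads n z (1\<^sub>m n)"
  then obtain d b j where d: "0 < d" "\<And>i j. i < n \<Longrightarrow> j < n \<Longrightarrow> coeff (1\<^sub>m n $$ (i, j) :: complex poly) d = b j * flip (\<lambda>i. z $ i) i"
    and j: "j < n" "b j \<noteq> 0"
    unfolding leads_def by blast
  have "coeff (1\<^sub>m n $$ (0, j) :: complex poly) d = 0" using n j d(1) by (auto simp: coeff_eq_0)
  then show False using d(2)[OF n j(1)] j z n by (simp add: flip_def Xi_real_iff)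
qed

text \<open>The quadratic term \<open>- 1/2 (g^T g) (z^T U) D z\<close> reaches degree
  \<open>2 m + e\<close>, where \<open>m\<close> is the degree of \<open>g\<close>, while the other
  terms stay at or below \<open>m + e\<close>.\<close>

lemma leads_G_mat_mult:
  assumes n: "0 < n" and z: "z \<in> Xi_real n" and g: "g \<in> Delta_real n z" "g \<noteq> 0\<^sub>v n"
    and U: "U \<in> carrier_mat n n" "\<And>i j. i < n \<Longrightarrow> j < n \<Longrightarrow> degree (U $$ (i, j)) \<le> e"
    and j: "j < n" "dot n (\<lambda>i. z $ i) (\<lambda>k. coeff (U $$ (k, j)) e) \<noteq> 0"
  shows "leads n z (G_mat n z 0 g * U)"
proof -
  define m where "m = Max ((\<lambda>i. degree (g $ i)) ` {..<n})"
  have m: "degree (g $ i) \<le> m" if "i < n" for i unfolding m_def using that by simp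
  have G: "g \<in> carrier_vec n" "\<And>i. i < n \<Longrightarrow> conjugate (g $ i) = g $ i \<and> poly (g $ i) 0 = 0" "g $ 0 = 0"
    using g z n by (auto simp: Delta_real_iff)
  obtain i where i: "i < n" "g $ i \<noteq> 0" using g G(1) by (metis eq_vecI carrier_vecD index_zero_vec)
  \<comment> \<open>Because \<open>g\<close> has no constant term, a nonzero entry is nonconstant;
    \<open>m > 0\<close> is what separates \<open>2 m + e\<close> from \<open>m + e\<close>.\<close>
  have "degree (g $ i) \<noteq> 0"
    using G(2)[OF i(1)] i(2) by (metis degree_0_id poly_0_coeff_0 pCons_0_0)
  then have "0 < m" using m[OF i(1)] by simp
  have "m \<in> (\<lambda>i. degree (g $ i)) ` {..<n}" unfolding m_def using n by (intro Max_in) auto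
  then obtain k where k: "k < n" "degree (g $ k) = m" by auto
  \<comment> \<open>The leading coefficient of \<open>g^T g\<close>; it is nonzero as a sum of
    squares of reals that are not all zero.\<close>
  define s where "s = dot n (\<lambda>i. coeff (g $ i) m) (\<lambda>i. coeff (g $ i) m)"
  have "coeff (g $ k) m \<noteq> 0" using k \<open>0 < m\<close> by auto
  moreover have "cnj (coeff (g $ i) m) = coeff (g $ i) m" if "i < n" for i
    using G(2)[OF that] by (metis coeff_conjugate_poly conjugate_complex_def)
  ultimately have s: "s \<noteq> 0"
    using dot_self_eq_0[of n "\<lambda>i. coeff (g $ i) m" k] k unfolding s_def by blast
  let ?q = "dot n (\<lambda>i. g $ i) (\<lambda>i. g $ i)"
  have q: "degree ?q \<le> m + m" "coeff ?q (m + m) = s"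
    unfolding s_def using m by (auto intro: degree_dot_le coeff_dot_top)
  let ?a = "\<lambda>j. dot n (\<lambda>i. z $ i) (\<lambda>k. coeff (U $$ (k, j)) e)"
  have main: "degree ((G_mat n z 0 g * U) $$ (i, j)) \<le> m + m + e \<and>
     coeff ((G_mat n z 0 g * U) $$ (i, j)) (m + m + e) = (- 1/2 * s * ?a j) * flip (\<lambda>i. z $ i) i"
    if ij: "i < n" "j < n" for i j
  proof -
    let ?u = "\<lambda>k. U $$ (k, j)"
    define p1 where "p1 = dot n (\<lambda>i. g $ i) ?u"
    define p2 where "p2 = dot n (cvec z) ?u"
    have p1: "degree p1 \<le> m + e" unfolding p1_def using m U ij by (intro degree_dot_le) auto
    have p2: "degree p2 \<le> e" "coeff p2 e = ?a j"
      unfolding p2_def using degree_dot_le[of n "cvec z" 0 ?u e] U ij by (auto simp: coeff_dot_const)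
    have f: "flip (cvec z) i = [:flip (\<lambda>i. z $ i) i:]" by (simp add: flip_const)
    have eq: "(G_mat n z 0 g * U) $$ (i, j) = ?u i + (Polynomial.smult (flip (\<lambda>i. z $ i) i) p1
        - Polynomial.smult (flip (\<lambda>i. z $ i) i * (1/2)) (?q * p2) - g $ i * p2)"
      unfolding index_G_mat_mult[OF n z g(1) U(1) ij] eichler_def Delta_real_eichler(3)[OF n z g(1)] f p1_def p2_def
      by (simp add: algebra_simps smult_diff_right)
    have qp: "degree (?q * p2) \<le> m + m + e" "coeff (?q * p2) (m + m + e) = s * ?a j"
      using degree_mult_bound[OF q(1) p2(1)] coeff_mult_top[OF q(1) p2(1)] q p2 by auto
    have gp: "degree (g $ i * p2) \<le> m + e" using degree_mult_bound[OF m p2(1)] ij by auto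
    have "degree (?u i) \<le> e" using U ij by auto
    then have "coeff (?u i) (m + m + e) = 0" "coeff p1 (m + m + e) = 0" "coeff (g $ i * p2) (m + m + e) = 0"
      using p1 gp \<open>0 < m\<close> by (auto intro!: coeff_eq_0)
    moreover have "degree ((G_mat n z 0 g * U) $$ (i, j)) \<le> m + m + e"
      unfolding eq using p1 gp qp \<open>degree (?u i) \<le> e\<close>
      by (intro degree_add_le degree_diff_le order_trans[OF degree_smult_le]) auto
    ultimately show ?thesis using qp unfolding eq by simp
  qed
  define b where "b j = - 1/2 * s * ?a j" for j
  have "0 < m + m + e" "\<exists>j<n. b j \<noteq> 0" using \<open>0 < m\<close> j s by (auto simp: b_def)
  moreover have "\<forall>i<n. \<forall>j<n. degree ((G_mat n z 0 g * U) $$ (i, j)) \<le> m + m + e \<and>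
     coeff ((G_mat n z 0 g * U) $$ (i, j)) (m + m + e) = b j * flip (\<lambda>i. z $ i) i"
    using main unfolding b_def by blast
  ultimately show ?thesis unfolding leads_def by blast
qed

lemma M_real0_group_mult: "x \<otimes>\<^bsub>M_real0_group n\<^esub> y = x * y"
  by (simp add: M_def)

text \<open>The word is built up from the right, and each new letter must meet a leading coefficient
  that \<open>z^T\<close> does not annihilate.\<close>

lemma leads_reduced_word:
  assumes n: "0 < n"
  shows "reduced_word (M_real0_group n) (Xi_real n) (M_real_at n) ((z, h) # w) \<Longrightarrow>
    leads n z (word_product (M_real0_group n) ((z, h) # w))"
proof (induction w arbitrary: z h)
  case Nil
  then have z: "z \<in> Xi_real n" and h: "h \<in> M_real_at n z" "h \<noteq> 1\<^sub>m n"
    by (auto simp: reduced_word_Cons M_def)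
  then obtain g where g: "g \<in> Delta_real n z" "h = G_mat n z 0 g" "g \<noteq> 0\<^sub>v n"
    using G_mat_zero[OF n z] by (auto simp: M_real_at_eq)
  \<comment> \<open>For a single letter the right factor is the identity with degree bound 0, and
    its column 0 pairs with \<open>z\<close> to \<open>z $ 0 = 1\<close>.\<close>
  have "dot n (\<lambda>i. z $ i) (\<lambda>k. coeff (1\<^sub>m n $$ (k, 0) :: complex poly) 0)
      = dot n (\<lambda>i. z $ i) (\<lambda>k. if k = 0 then 1 else 0)"
    by (rule dot_cong) (use n in auto)
  also have "\<dots> \<noteq> 0" using dot_unit[OF n, of "\<lambda>i. z $ i"] z n by (simp add: Xi_real_iff)
  finally have "leads n z (G_mat n z 0 g * 1\<^sub>m n)"
    by (intro leads_G_mat_mult[OF n z g(1,3), where e = 0 and j = 0]) (use n in auto)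
  then show ?case by (simp add: g M_def)
next
  case (Cons p w)
  obtain y k where p: "p = (y, k)" by (cases p)
  let ?U = "word_product (M_real0_group n) (p # w)"
  have z: "z \<in> Xi_real n" and h: "h \<in> M_real_at n z" "h \<noteq> 1\<^sub>m n" and "z \<noteq> y" "y \<in> Xi_real n"
    and r: "reduced_word (M_real0_group n) (Xi_real n) (M_real_at n) (p # w)"
    using Cons.prems by (auto simp: reduced_word_Cons M_def p)
  then obtain g where g: "g \<in> Delta_real n z" "h = G_mat n z 0 g" "g \<noteq> 0\<^sub>v n"
    using G_mat_zero[OF n z] by (auto simp: M_real_at_eq)
  have U: "?U \<in> carrier_mat n n"
    using group.word_product_closed[OF group_M_real0 subgroup_M_real_at[OF n] r] M_real0_carrier by simp
  have "leads n y ?U" using Cons.IH r by (simp only: p)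
  then obtain d b j where d: "\<And>i j. i < n \<Longrightarrow> j < n \<Longrightarrow> degree (?U $$ (i, j)) \<le> d"
      "\<And>i j. i < n \<Longrightarrow> j < n \<Longrightarrow> coeff (?U $$ (i, j)) d = b j * flip (\<lambda>i. y $ i) i" and j: "j < n" "b j \<noteq> 0"
    unfolding leads_def by blast
  \<comment> \<open>Column \<open>j\<close> of the tail has leading coefficient \<open>b j\<close>
    times \<open>D y\<close>, and \<open>z^T D y \<noteq> 0\<close> because neighbouring indices
    differ.\<close>
  have "dot n (\<lambda>i. z $ i) (\<lambda>k. coeff (?U $$ (k, j)) d) = dot n (\<lambda>i. z $ i) (\<lambda>k. b j * flip (\<lambda>i. y $ i) k)"
    using d(2) j by (intro dot_cong) auto
  also have "\<dots> \<noteq> 0"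
    using Xi_real_nonorthogonal[OF n z \<open>y \<in> Xi_real n\<close>] \<open>z \<noteq> y\<close> j by (auto simp: dot_linear)
  finally have ne: "dot n (\<lambda>i. z $ i) (\<lambda>k. coeff (?U $$ (k, j)) d) \<noteq> 0" .
  have "leads n z (G_mat n z 0 g * ?U)"
    by (rule leads_G_mat_mult[OF n z g(1,3) U _ j(1) ne]) (rule d(1))
  then show ?case unfolding word_product_Cons g(2) M_real0_group_mult .
qed

section \<open>Degree reduction\<close>

text \<open>The left-hand side is the coefficient of degree \<open>a + b > 0\<close> in a constant
  polynomial.\<close>

lemma coeff_dot_form_const:
  assumes "\<And>i. i < n \<Longrightarrow> degree (x i) \<le> a" "\<And>i. i < n \<Longrightarrow> degree (y i) \<le> b"
    and "degree (dot n x (flip y)) = 0" "0 < a + b"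
  shows "dot n (\<lambda>i. coeff (x i) a) (flip (\<lambda>i. coeff (y i) b)) = 0"
proof -
  have "coeff (dot n x (flip y)) (a + b) = dot n (\<lambda>i. coeff (x i) a) (\<lambda>i. coeff (flip y i) b)"
    by (rule coeff_dot_top) (use assms in auto)
  moreover have "coeff (dot n x (flip y)) (a + b) = 0"
    by (rule coeff_eq_0) (use assms in simp)
  moreover have "(\<lambda>i. coeff (flip y i) b) = flip (\<lambda>i. coeff (y i) b)"
    by (rule ext) (rule coeff_flip)
  ultimately show ?thesis by simp
qed

text \<open>Expanding gives \<open>y^T D y = r^T D r + 2 \<beta> (\<zeta>^T r)\<close>. The
  left-hand side is constant and \<open>r^T D r\<close> has degree at most \<open>2 m\<close>, so
  the product of \<open>\<beta>\<close> with a polynomial of degree \<open>m\<close> has degree at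
  most \<open>2 m\<close>.\<close>

lemma degree_coefficient_of_isotropic_le:
  fixes \<zeta> r y :: "nat \<Rightarrow> complex poly"
  assumes z: "dot n \<zeta> (flip \<zeta>) = 0"
    and y: "\<And>k. k < n \<Longrightarrow> y k = r k + \<beta> * flip \<zeta> k"
    and r: "\<And>k. k < n \<Longrightarrow> degree (r k) \<le> m"
    and A: "dot n \<zeta> r \<noteq> 0" "degree (dot n \<zeta> r) = m"
    and const: "degree (dot n y (flip y)) = 0"
  shows "degree \<beta> \<le> m"
proof (cases "\<beta> = 0")
  case False
  let ?A = "dot n \<zeta> r"
  have "dot n y (flip y) = dot n (\<lambda>k. r k + \<beta> * flip \<zeta> k) (flip (\<lambda>k. r k + \<beta> * flip \<zeta> k))"
    by (rule dot_cong) (auto simp: flip_def y)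
  also have "\<dots> = dot n r (flip r) + 2 * (\<beta> * ?A)"
  proof -
    have 1: "dot n (flip \<zeta>) (flip r) = ?A" "dot n (flip \<zeta>) \<zeta> = 0" "dot n r \<zeta> = ?A"
      using z dot_flip_left[of n \<zeta> \<zeta>] dot_flip_left[of n \<zeta> "flip r"] by (auto simp: dot_commute[of n r])
    show ?thesis unfolding dot_linear flip_linear flip_flip 1 by (simp add: algebra_simps)
  qed
  finally have "2 * (\<beta> * ?A) = dot n y (flip y) - dot n r (flip r)" by simp
  moreover have "degree (dot n r (flip r)) \<le> m + m"
    by (rule degree_dot_le) (use r in auto)
  ultimately have "degree (2 * (\<beta> * ?A)) \<le> m + m"
    using const by (metis degree_diff_le le0)
  moreover have "2 * (\<beta> * ?A) = Polynomial.smult 2 (\<beta> * ?A)" by (simp add: numeral_poly)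
  ultimately show ?thesis using A False by (simp add: degree_mult_eq)
qed simp

text \<open>Suppose \<open>w\<close> has degree \<open>K > m\<close>. Its top coefficient
  \<open>a\<close> is isotropic with \<open>z^T a = 0\<close>, hence a multiple of
  \<open>D z\<close>. It is also orthogonal to the coefficient of degree \<open>m\<close> of
  \<open>y\<close>, whose pairing with \<open>z\<close> is nonzero, so the multiple is zero.\<close>

lemma degree_le_of_column_relations:
  assumes n: "0 < n" and z: "z \<in> Xi_real n"
    and real: "\<And>k. k < n \<Longrightarrow> conjugate (w k) = w k"
    and y: "\<And>k. k < n \<Longrightarrow> degree (y k) \<le> m" "coeff (dot n (cvec z) y) m \<noteq> 0"
    and w: "degree (dot n (cvec z) w) \<le> m"
    and ww: "degree (dot n w (flip w)) = 0" and yw: "degree (dot n y (flip w)) = 0"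
    and k: "k < n"
  shows "degree (w k) \<le> m"
proof (rule ccontr)
  assume "\<not> degree (w k) \<le> m"
  define K where "K = Max ((\<lambda>i. degree (w i)) ` {..<n})"
  have K: "degree (w i) \<le> K" if "i < n" for i unfolding K_def using that by simp
  have "m < K" using K[OF k] \<open>\<not> degree (w k) \<le> m\<close> by simp
  have "K \<in> (\<lambda>i. degree (w i)) ` {..<n}" unfolding K_def using n by (intro Max_in) auto
  then obtain l where l: "l < n" "degree (w l) = K" by auto
  define a where "a = (\<lambda>i. coeff (w i) K)"
  have areal: "cnj (a i) = a i" if "i < n" for i
    using real[OF that] unfolding a_def by (metis coeff_conjugate_poly conjugate_complex_def)
  have aa: "dot n a (flip a) = 0"
    unfolding a_def by (rule coeff_dot_form_const) (use K ww \<open>m < K\<close> in auto)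
  have ya: "dot n (\<lambda>i. coeff (y i) m) (flip a) = 0"
    unfolding a_def by (rule coeff_dot_form_const) (use y K yw \<open>m < K\<close> in auto)
  have za: "dot n (\<lambda>i. z $ i) a = 0"
    using w \<open>m < K\<close> unfolding a_def coeff_dot_const[symmetric] by (simp add: coeff_eq_0)
  let ?z = "\<lambda>i. z $ i"
  \<comment> \<open>Coordinate 0 of \<open>D z\<close> is -1, so this combination has vanishing
    coordinate 0; it is isotropic because \<open>a\<close> and \<open>D z\<close> are isotropic and
    orthogonal.\<close>
  let ?f = "\<lambda>i. a i + a 0 * flip ?z i"
  have Z: "z $ 0 = 1" "dot n ?z (flip ?z) = 0" "\<And>i. i < n \<Longrightarrow> cnj (z $ i) = z $ i"
    using z n by (auto simp: Xi_real_iff)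
  have "dot n (flip ?z) (flip a) = 0" "dot n (flip ?z) ?z = 0" "dot n a ?z = 0"
    using za Z dot_flip_left[of n ?z "flip a"] dot_flip_left[of n ?z ?z] by (auto simp: dot_commute[of n a])
  then have f0: "dot n ?f (flip ?f) = 0"
    unfolding dot_linear flip_linear flip_flip by (simp add: aa)
  have f: "?f i = 0" if "i < n" for i
    by (rule isotropic_eq_0[of n ?f, OF _ f0]) (use that areal n Z in \<open>auto simp: flip_def\<close>)
  then have ai: "a i = - a 0 * flip ?z i" if "i < n" for i
    using that by (simp add: eq_neg_iff_add_eq_0)
  have "dot n (\<lambda>i. coeff (y i) m) (flip a) = dot n (\<lambda>i. coeff (y i) m) (\<lambda>i. - a 0 * z $ i)"
  proof (rule dot_cong)
    fix i assume "i < n"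
    show "flip a i = - a 0 * z $ i"
      using ai[OF \<open>i < n\<close>] Z(1) by (cases "i = 0") (simp_all add: flip_def)
  qed simp
  also have "\<dots> = - a 0 * coeff (dot n (cvec z) y) m"
    unfolding coeff_dot_const dot_linear by (simp add: dot_commute)
  finally have "a 0 = 0" using ya y by simp
  then have "a l = 0" using ai[OF l(1)] by simp
  then show False using l \<open>m < K\<close> unfolding a_def by auto
qed

section \<open>Division with remainder for polynomial vectors\<close>

text \<open>Division by a fixed polynomial is linear over the constants, so it preserves
  orthogonality to \<open>z\<close>.\<close>

lemma dot_const_div:
  fixes p :: "nat \<Rightarrow> complex poly"
  shows "dot n (\<lambda>k. [:f k:]) (\<lambda>k. p k div A) = dot n (\<lambda>k. [:f k:]) p div A"
proof (induction n)
  case (Suc n)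
  have "dot (Suc n) (\<lambda>k. [:f k:]) q = dot n (\<lambda>k. [:f k:]) q + Polynomial.smult (f n) (q n)" for q
    by (simp add: dot_def)
  then show ?case by (simp add: Suc poly_div_add_left div_smult_left)
qed (simp add: dot_def)

text \<open>Conjugation preserves degrees and hence carries a division with remainder to another
  one. This makes the quotients that define \<open>g\<close> real.\<close>

lemma conjugate_div_poly:
  fixes p q :: "complex poly"
  shows "conjugate (p div q) = conjugate p div conjugate q"
proof (cases "q = 0")
  case False
  have deg: "degree (conjugate r) = degree r" for r :: "complex poly"
  proof -
    have le: "degree (conjugate s) \<le> degree s" for s :: "complex poly"
      by (rule degree_le) (simp add: coeff_conjugate_poly coeff_eq_0)
    show ?thesis using le[of r] le[of "conjugate r"] by simp
  qed
  have "conjugate p = conjugate (p div q) * conjugate q + conjugate (p mod q)"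
    by (simp flip: conjugate_dist_mul conjugate_dist_add)
  then have "conjugate p div conjugate q = conjugate (p div q) + conjugate (p mod q) div conjugate q"
    using False by simp
  moreover have "conjugate (p mod q) div conjugate q = 0"
    using degree_mod_less[OF False, of p] by (auto simp: div_poly_eq_0_iff deg)
  ultimately show ?thesis by simp
qed simp

text \<open>The Euclidean projection of \<open>x\<close> to the orthogonal complement of \<open>z\<close> and \<open>D z\<close> is divided
  by \<open>A = z\<^sup>T x\<close>. The constant term of the quotient has to be dropped, which leaves the degree at
  \<open>degree A\<close> instead of below it.\<close>

lemma Delta_real_division:
  assumes n: "0 < n" and z: "z \<in> Xi_real n"
    and x: "\<And>k. k < n \<Longrightarrow> conjugate (x k) = x k" and A: "A = dot n (cvec z) x" "A \<noteq> 0"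
  obtains g r \<beta> where "g \<in> Delta_real n z"
    "\<And>k. k < n \<Longrightarrow> eichler n (cvec z) (\<lambda>k. g $ k) x k = r k + \<beta> * flip (cvec z) k"
    "\<And>k. k < n \<Longrightarrow> degree (r k) \<le> degree A"
proof -
  let ?z = "cvec z" and ?B = "dot n (flip (cvec z)) x"
  have Z: "z $ 0 = 1" "dot n (\<lambda>i. z $ i) (flip (\<lambda>i. z $ i)) = 0" "\<And>i. i < n \<Longrightarrow> cnj (z $ i) = z $ i"
    using z n by (auto simp: Xi_real_iff)
  have zf: "conjugate (?z k) = ?z k" "conjugate (flip ?z k) = flip ?z k" if "k < n" for k
    using Z(3)[OF that] by (auto simp: flip_def conjugate_const_poly)
  \<comment> \<open>As \<open>z $ 0 = 1\<close>, the vector \<open>z - D z\<close> is twice the unit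
    vector of coordinate 0.\<close>
  have diff: "dot n ?z q - dot n (flip ?z) q = q 0 + q 0" for q
  proof -
    have "dot n ?z q - dot n (flip ?z) q = dot n (\<lambda>i. ?z i - flip ?z i) q" by (simp only: dot_linear)
    also have "\<dots> = (\<Sum>i<n. if i = 0 then q 0 + q 0 else 0)"
      unfolding dot_def by (rule sum.cong) (auto simp: flip_def Z(1) numeral_poly)
    finally show ?thesis using n by simp
  qed
  have zz: "dot n ?z (flip ?z) = 0" by (rule dot_const_isotropic[OF z n])
  then have z2: "dot n ?z ?z = 1 + 1"
    using diff[of ?z] dot_flip_left[of n ?z ?z] Z(1) by (simp add: one_pCons)
  \<comment> \<open>In the Euclidean pairing \<open>z\<close> and \<open>D z\<close> are orthogonal
    of squared length 2, whence the factors one half. Coordinate 0 of the projection vanishes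
    because its unit vector lies in the removed span.\<close>
  define P where "P k = x k - half * A * ?z k - half * ?B * flip ?z k" for k
  define \<gamma> where "\<gamma> k = P k div A - [:poly (P k div A) 0:]" for k
  define g where "g = vec n \<gamma>"
  have "P 0 = x 0 - half * (dot n ?z x - ?B)"
    by (simp add: P_def A(1) flip_def Z(1) one_pCons[symmetric] right_diff_distrib smult_diff_right)
  then have P0: "P 0 = 0" unfolding diff distrib_left half_double by simp
  have "dot n ?z P = A - half * A * dot n ?z ?z"
    unfolding P_def[abs_def] dot_linear zz A(1)[symmetric] by simp
  also have "\<dots> = 0" unfolding z2 distrib_left mult_1_right half_double by simp
  finally have zP: "dot n ?z P = 0" .
  have "dot n ?z (\<lambda>k. P k div A) = 0" by (simp add: dot_const_div zP)
  moreover have "dot n ?z (\<lambda>k. [:poly (P k div A) 0:]) = 0"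
  proof -
    have "dot n (\<lambda>k. z $ k) (\<lambda>k. poly (P k div A) 0) = poly (dot n ?z (\<lambda>k. P k div A)) 0"
      by (simp add: dot_def poly_sum)
    then show ?thesis using \<open>dot n ?z (\<lambda>k. P k div A) = 0\<close> by (simp add: dot_const)
  qed
  ultimately have z\<gamma>: "dot n ?z \<gamma> = 0" unfolding \<gamma>_def[abs_def] dot_linear by simp
  have conjA: "conjugate A = A"
    unfolding A(1) dot_def by (simp add: sum_conjugate conjugate_dist_mul zf x del: mult_pCons_left)
  have conjB: "conjugate ?B = ?B"
    unfolding dot_def by (simp add: sum_conjugate conjugate_dist_mul zf x del: mult_pCons_left)
  have conjP: "conjugate (P k div A) = P k div A" if "k < n" for k
    unfolding conjugate_div_poly conjA P_def
    by (simp add: diff_conv_add_uminus conjugate_dist_add conjugate_neg conjugate_dist_mul conjA conjB zf x that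
      conjugate_const_poly[of "1/2"] del: add_uminus_conv_diff mult_pCons_left mult_pCons_right)
  have conj\<gamma>: "conjugate (\<gamma> k) = \<gamma> k" if "k < n" for k
  proof -
    have "cnj (poly (P k div A) 0) = poly (P k div A) 0"
      using conjP[OF that] by (metis coeff_conjugate_poly conjugate_complex_def poly_0_coeff_0)
    then show ?thesis
      unfolding \<gamma>_def diff_conv_add_uminus conjugate_dist_add conjugate_neg conjP[OF that] conjugate_const_poly
      by simp
  qed
  have "dot n ?z (\<lambda>k. g $ k) = dot n ?z \<gamma>" by (rule dot_cong) (auto simp: g_def)
  then have g: "g \<in> Delta_real n z"
    unfolding Delta_real_iff[OF n z] using n z\<gamma> conj\<gamma> P0 by (auto simp: g_def) (simp_all add: \<gamma>_def)
  \<comment> \<open>\<open>r\<close> collects the remainder, the dropped constant times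
    \<open>A\<close> and the part along \<open>z\<close>, each of degree at most
    \<open>degree A\<close>. All multiples of \<open>D z\<close> go into \<open>\<beta>\<close>,
    whose degree is not controlled here.\<close>
  define r where "r k = P k mod A + A * [:poly (P k div A) 0:] + half * A * ?z k" for k
  define \<beta> where "\<beta> = dot n \<gamma> x - half * dot n \<gamma> \<gamma> * A + half * ?B"
  have \<gamma>f: "flip \<gamma> = \<gamma>" using P0 by (auto simp: flip_def \<gamma>_def)
  have eq: "eichler n ?z (\<lambda>k. g $ k) x k = r k + \<beta> * flip ?z k" if "k < n" for k
  proof -
    have "eichler n ?z (\<lambda>k. g $ k) x k = eichler n ?z \<gamma> x k"
      by (rule eichler_cong) (use that in \<open>auto simp: g_def\<close>)
    also have "\<dots> = x k + ((dot n \<gamma> x - half * dot n \<gamma> \<gamma> * A) * flip ?z k - A * \<gamma> k)"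
      unfolding eichler_def \<gamma>f A(1) ..
    finally have 1: "eichler n ?z (\<lambda>k. g $ k) x k = \<dots>" .
    have 2: "x k = A * (P k div A) + P k mod A + half * A * ?z k + half * ?B * flip ?z k"
      by (simp only: mult_div_mod_eq) (simp add: P_def)
    show ?thesis
      unfolding 1 r_def \<beta>_def \<gamma>_def by (subst 2) (simp only: algebra_simps)
  qed
  have "degree (P k mod A) \<le> degree A" for k
    using degree_mod_less[OF A(2), of "P k"] by auto
  then have "degree (r k) \<le> degree A" for k
    unfolding r_def
    by (intro degree_add_le order_trans[OF degree_mult_le]) (auto simp: order_trans[OF degree_smult_le])
  then show thesis using that[OF g eq] by blast
qed

lemma degree_reduction:
  assumes n: "0 < n" and U: "U \<in> M_real0 n"
    and deg: "\<And>i j. i < n \<Longrightarrow> j < n \<Longrightarrow> degree (U $$ (i, j)) \<le> Suc d"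
    and c: "b < n" "c < n" "coeff (U $$ (b, c)) (Suc d) \<noteq> 0"
  shows "\<exists>z\<in>Xi_real n. \<exists>g\<in>Delta_real n z. \<forall>i<n. \<forall>j<n. degree ((G_mat n z 0 g * U) $$ (i, j)) \<le> d"
proof -
  have Uc: "U \<in> carrier_mat n n" by (rule M_real0_carrier[OF U])
  define a where "a j = (\<lambda>k. coeff (U $$ (k, j)) (Suc d))" for j
  have form: "degree (dot n (\<lambda>k. V $$ (k, i)) (flip (\<lambda>k. V $$ (k, j)))) = 0"
    if "V \<in> M_real0 n" "i < n" "j < n" for V i j
    unfolding M_real0_columns[OF that] Dmat_index[OF that(2,3)] by simp
  have orth: "dot n (a i) (flip (a j)) = 0" if "i < n" "j < n" for i j
    unfolding a_def by (rule coeff_dot_form_const) (use deg that form[OF U] in auto)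
  have areal: "cnj (a j k) = a j k" if "j < n" "k < n" for j k
    unfolding a_def using M_real0_conjugate[OF U that(2,1)] by (metis coeff_conjugate_poly conjugate_complex_def)
  \<comment> \<open>A nonzero real isotropic vector has nonzero coordinate 0, and entry
    \<open>b\<close> shows that \<open>a c\<close> is nonzero.\<close>
  have a0: "a c 0 \<noteq> 0"
    using isotropic_eq_0[of n "a c" b] orth[OF c(2) c(2)] areal[OF c(2)] c by (auto simp: a_def)
  \<comment> \<open>The scaling makes coordinate 0 of \<open>z\<close> equal to 1; the sign
    compensates that of \<open>D\<close>.\<close>
  define s where "s = - inverse (a c 0)"
  define z where "z = vec n (\<lambda>k. s * flip (a c) k)"
  have dz: "dot n (\<lambda>k. z $ k) f = s * dot n (flip (a c)) f" for f
  proof -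
    have "dot n (\<lambda>k. z $ k) f = dot n (\<lambda>k. s * flip (a c) k) f"
      by (rule dot_cong) (auto simp: z_def)
    then show ?thesis by (simp only: dot_linear)
  qed
  have zz: "dot n (\<lambda>k. z $ k) (flip (\<lambda>k. z $ k)) = 0"
  proof -
    have "dot n (\<lambda>k. z $ k) (flip (\<lambda>k. z $ k)) = dot n (\<lambda>k. s * flip (a c) k) (\<lambda>k. s * a c k)"
      by (rule dot_cong) (auto simp: z_def flip_def)
    also have "\<dots> = s * (s * dot n (flip (a c)) (a c))" by (simp only: dot_linear)
    also have "\<dots> = 0" using orth[OF c(2) c(2)] by (simp add: dot_flip_left)
    finally show ?thesis .
  qed
  have z: "z \<in> Xi_real n"
    unfolding Xi_real_iff[OF n] using zz n a0 areal[OF c(2)]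
    by (auto simp: z_def s_def flip_def)
  define \<alpha> where "\<alpha> j = dot n (cvec z) (\<lambda>k. U $$ (k, j))" for j
  \<comment> \<open>The coefficient of degree \<open>Suc d\<close> of \<open>z^T U\<close> is a
    multiple of the form evaluated on the leading coefficients of columns \<open>c\<close> and
    \<open>j\<close>, which are orthogonal.\<close>
  have \<alpha>: "degree (\<alpha> j) \<le> d" if "j < n" for j
  proof -
    have "degree (\<alpha> j) \<le> Suc d"
      unfolding \<alpha>_def using degree_dot_le[of n "cvec z" 0 "\<lambda>k. U $$ (k, j)" "Suc d"] deg that by auto
    moreover have "coeff (\<alpha> j) (Suc d) = s * dot n (flip (a c)) (a j)"
      unfolding \<alpha>_def coeff_dot_const a_def[symmetric] dz by simp
    then have "coeff (\<alpha> j) (Suc d) = 0" using orth[OF c(2) that] by (simp add: dot_flip_left)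
    ultimately show ?thesis
      by (metis le_SucE leading_coeff_0_iff degree_0 le0)
  qed
  \<comment> \<open>At 0 the matrix \<open>U\<close> is the identity, so \<open>\<alpha> 0\<close>
    takes the value \<open>z $ 0 = 1\<close> there.\<close>
  have "poly (\<alpha> 0) 0 = dot n (\<lambda>k. z $ k) (\<lambda>k. if k = 0 then 1 else 0)"
    unfolding \<alpha>_def dot_def poly_sum using M_real0_at_0[OF U _ n] by (intro sum.cong) auto
  then have \<alpha>0: "\<alpha> 0 \<noteq> 0"
    using dot_unit[OF n, of "\<lambda>k. z $ k"] z n by (auto simp: Xi_real_iff)
  \<comment> \<open>The chosen entry has to be nonzero to serve as divisor, and of maximal degree to
    bound the pairings of all columns with \<open>z\<close>. The zero polynomial also has degree 0,
    so the maximum is taken over nonzero entries.\<close>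
  obtain i where i: "i < n" "\<alpha> i \<noteq> 0" and max: "\<And>j. j < n \<Longrightarrow> degree (\<alpha> j) \<le> degree (\<alpha> i)"
  proof -
    let ?S = "{j. j < n \<and> \<alpha> j \<noteq> 0}"
    have S: "finite ?S" "?S \<noteq> {}" using n \<alpha>0 by auto
    then have "Max ((\<lambda>j. degree (\<alpha> j)) ` ?S) \<in> (\<lambda>j. degree (\<alpha> j)) ` ?S" by (intro Max_in) auto
    then obtain i where "i \<in> ?S" "degree (\<alpha> i) = Max ((\<lambda>j. degree (\<alpha> j)) ` ?S)" by auto
    moreover have "degree (\<alpha> j) \<le> Max ((\<lambda>j. degree (\<alpha> j)) ` ?S)" if "j < n" for j
      using that S by (cases "\<alpha> j = 0") auto
    ultimately show thesis using that by auto
  qed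
  let ?x = "\<lambda>k. U $$ (k, i)"
  obtain g r \<beta> where g: "g \<in> Delta_real n z"
    and eq: "\<And>k. k < n \<Longrightarrow> eichler n (cvec z) (\<lambda>k. g $ k) ?x k = r k + \<beta> * flip (cvec z) k"
    and r: "\<And>k. k < n \<Longrightarrow> degree (r k) \<le> degree (\<alpha> i)"
    using Delta_real_division[OF n z, of ?x "\<alpha> i"] M_real0_conjugate[OF U _ i(1)] i(2)
    unfolding \<alpha>_def by metis
  define V where "V = G_mat n z 0 g * U"
  have V: "V \<in> M_real0 n" unfolding V_def by (rule mult_in_M_real0[OF G_mat_in_M_real0[OF n z g] U])
  have Vij: "V $$ (k, j) = eichler n (cvec z) (\<lambda>k. g $ k) (\<lambda>k. U $$ (k, j)) k" if "k < n" "j < n" for k j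
    unfolding V_def by (rule index_G_mat_mult[OF n z g Uc that])
  have \<zeta>: "dot n (cvec z) (flip (cvec z)) = 0" by (rule dot_const_isotropic[OF z n])
  have \<alpha>V: "dot n (cvec z) (\<lambda>k. V $$ (k, j)) = \<alpha> j" if "j < n" for j
  proof -
    have "dot n (cvec z) (\<lambda>k. V $$ (k, j)) = dot n (cvec z) (eichler n (cvec z) (\<lambda>k. g $ k) (\<lambda>k. U $$ (k, j)))"
      by (rule dot_cong) (simp_all add: Vij that)
    also have "\<dots> = \<alpha> j"
      unfolding \<alpha>_def by (rule dot_eichler) (use Delta_real_eichler[OF n z g] in auto)
    finally show ?thesis .
  qed
  let ?m = "degree (\<alpha> i)"
  have Vi: "V $$ (k, i) = r k + \<beta> * flip (cvec z) k" if "k < n" for k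
    using Vij[OF that i(1)] eq[OF that] by simp
  \<comment> \<open>The Eichler transformation preserves the pairing with \<open>z\<close>, and
    \<open>z^T\<close> annihilates \<open>D z\<close>; so \<open>z^T r\<close> is again
    \<open>\<alpha> i\<close>, as the bound on \<open>\<beta>\<close> requires.\<close>
  have "\<alpha> i = dot n (cvec z) (\<lambda>k. r k + \<beta> * flip (cvec z) k)"
    unfolding \<alpha>V[OF i(1), symmetric] by (rule dot_cong) (simp_all add: Vi)
  also have "\<dots> = dot n (cvec z) r" unfolding dot_linear \<zeta> by simp
  finally have \<alpha>r: "\<alpha> i = dot n (cvec z) r" .
  have "degree \<beta> \<le> ?m"
    by (rule degree_coefficient_of_isotropic_le[OF \<zeta> Vi r])
      (use \<alpha>r i form[OF V i(1) i(1)] in auto)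
  then have Vdeg: "degree (V $$ (k, i)) \<le> ?m" if "k < n" for k
    unfolding Vi[OF that] flip_const using r[OF that]
    by (intro degree_add_le) (auto intro: order_trans[OF degree_smult_le])
  \<comment> \<open>Column \<open>i\<close> plays the role of \<open>y\<close>: the coefficient of
    degree \<open>?m\<close> of its pairing with \<open>z\<close> is the leading coefficient of
    \<open>\<alpha> i\<close>.\<close>
  have "degree (V $$ (k, j)) \<le> ?m" if "k < n" "j < n" for k j
    by (rule degree_le_of_column_relations[OF n z, of "\<lambda>k. V $$ (k, j)" "\<lambda>k. V $$ (k, i)"])
      (use that M_real0_conjugate[OF V] Vdeg \<alpha>V max i form[OF V] in auto)
  then have "\<forall>k<n. \<forall>j<n. degree ((G_mat n z 0 g * U) $$ (k, j)) \<le> d"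
    using \<alpha>[OF i(1)] unfolding V_def by (meson le_trans)
  then show ?thesis using z g by blast
qed

section \<open>Existence of reduced words\<close>

text \<open>Induction on a degree bound. A constant matrix equals its value at 0, the identity. If
  the bound is attained, \<open>degree_reduction\<close> lowers it by a left factor, whose inverse
  \<open>G_mat n z 0 (- g)\<close> is prepended to the word of the reduced matrix.\<close>

lemma M_real0_generated:
  assumes n: "0 < n"
  shows "U \<in> M_real0 n \<Longrightarrow> (\<And>i j. i < n \<Longrightarrow> j < n \<Longrightarrow> degree (U $$ (i, j)) \<le> d) \<Longrightarrow>
    \<exists>w. reduced_word (M_real0_group n) (Xi_real n) (M_real_at n) w \<and> word_product (M_real0_group n) w = U"
proof (induction d arbitrary: U)
  case 0
  have "U $$ (i, j) = (if i = j then 1 else 0)" if "i < n" "j < n" for i j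
  proof -
    have "degree (U $$ (i, j)) = 0" using 0(2)[OF that] by simp
    then have "U $$ (i, j) = [:poly (U $$ (i, j)) 0:]" by (metis degree_0_id poly_0_coeff_0)
    also have "\<dots> = (if i = j then 1 else 0)" by (simp add: M_real0_at_0[OF 0(1) that] one_pCons)
    finally show ?thesis .
  qed
  then have "U = 1\<^sub>m n" using M_real0_carrier[OF 0(1)] by (intro eq_matI) auto
  then show ?case by (intro exI[of _ "[]"]) (simp add: M_def)
next
  case (Suc d)
  show ?case
  proof (cases "\<exists>b<n. \<exists>c<n. coeff (U $$ (b, c)) (Suc d) \<noteq> 0")
    case True
    then obtain b c where bc: "b < n" "c < n" "coeff (U $$ (b, c)) (Suc d) \<noteq> 0" by blast
    obtain z g where z: "z \<in> Xi_real n" and g: "g \<in> Delta_real n z"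
      and deg: "\<And>i j. i < n \<Longrightarrow> j < n \<Longrightarrow> degree ((G_mat n z 0 g * U) $$ (i, j)) \<le> d"
      using degree_reduction[OF n Suc.prems(1) _ bc] Suc.prems(2) by blast
    have U: "U \<in> carrier_mat n n" by (rule M_real0_carrier[OF Suc.prems(1)])
    obtain w where w: "reduced_word (M_real0_group n) (Xi_real n) (M_real_at n) w"
      "word_product (M_real0_group n) w = G_mat n z 0 g * U"
      using Suc.IH[of "G_mat n z 0 g * U"] mult_in_M_real0[OF G_mat_in_M_real0[OF n z g] Suc.prems(1)] deg
      by blast
    have mg: "- g \<in> Delta_real n z" by (rule Delta_real_uminus[OF n z g])
    have "- g + g = 0\<^sub>v n" using g n z by (auto simp: Delta_real_iff)
    then have "G_mat n z 0 (- g) * G_mat n z 0 g = 1\<^sub>m n"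
      using G_mat_add[OF n z mg g] G_mat_zero[OF n z] by simp
    then have "G_mat n z 0 (- g) * (G_mat n z 0 g * U) = U"
      using U by (simp add: assoc_mult_mat[OF G_mat_carrier G_mat_carrier U, symmetric])
    moreover have "\<exists>v. reduced_word (M_real0_group n) (Xi_real n) (M_real_at n) v \<and>
        word_product (M_real0_group n) v = G_mat n z 0 (- g) \<otimes>\<^bsub>M_real0_group n\<^esub> word_product (M_real0_group n) w"
      by (rule group.reduced_word_prepend[OF group_M_real0 subgroup_M_real_at[OF n] w(1) z])
        (use mg in \<open>auto simp: M_real_at_eq\<close>)
    ultimately show ?thesis unfolding w(2) M_real0_group_mult by simp
  next
    case False
    have "degree (U $$ (i, j)) \<le> d" if "i < n" "j < n" for i j
    proof (rule degree_le, intro allI impI)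
      fix k assume "d < k"
      show "coeff (U $$ (i, j)) k = 0"
      proof (cases "k = Suc d")
        case False
        then show ?thesis using \<open>d < k\<close> Suc.prems(2)[OF that] by (intro coeff_eq_0) simp
      qed (use \<open>\<not> (\<exists>b<n. \<exists>c<n. coeff (U $$ (b, c)) (Suc d) \<noteq> 0)\<close> that in auto)
    qed
    then show ?thesis by (rule Suc.IH[OF Suc.prems(1)])
  qed
qed

lemma M_real0_reduced_word:
  assumes n: "0 < n" and U: "U \<in> M_real0 n"
  shows "\<exists>w. reduced_word (M_real0_group n) (Xi_real n) (M_real_at n) w \<and> word_product (M_real0_group n) w = U"
proof (rule M_real0_generated[OF n U])
  fix i j assume "i < n" "j < n"
  then show "degree (U $$ (i, j)) \<le> Max ((\<lambda>(i, j). degree (U $$ (i, j))) ` ({..<n} \<times> {..<n}))"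
    by (intro Max_ge) auto
qed

lemma free_product_M_real0:
  assumes n: "0 < n"
  shows "is_free_product_of (M_real0_group n) (Xi_real n) (M_real_at n)"
proof (rule is_free_product_ofI[where Q = "leads n"])
  show "\<exists>w. reduced_word (M_real0_group n) (Xi_real n) (M_real_at n) w \<and> word_product (M_real0_group n) w = U"
    if "U \<in> carrier (M_real0_group n)" for U
    using M_real0_reduced_word[OF n] that by simp
  show "\<not> leads n z \<one>\<^bsub>M_real0_group n\<^esub>" if "z \<in> Xi_real n" for z
    using not_leads_one[OF n that] by (simp add: M_def)
qed (fact group_M_real0 subgroup_M_real_at[OF n] leads_reduced_word[OF n] leads_unique[OF n])+

section \<open>Dimension two and larger dimensions\<close>

text \<open>Isotropy forces \<open>z $ 1 \<noteq> 0\<close>, so \<open>z^T g = 0\<close> and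
  \<open>g $ 0 = 0\<close> leave no freedom.\<close>

lemma Delta_real_two:
  assumes z: "z \<in> Xi_real 2" and g: "g \<in> Delta_real 2 z"
  shows "g = 0\<^sub>v 2"
proof -
  have Z: "z $ 0 = 1" "dot 2 (\<lambda>i. z $ i) (flip (\<lambda>i. z $ i)) = 0" using z by (auto simp: Xi_real_iff)
  have G: "g \<in> carrier_vec 2" "g $ 0 = 0" "dot 2 (cvec z) (\<lambda>i. g $ i) = 0" using z g by (auto simp: Delta_real_iff)
  have two: "{..<2} = {0, 1 :: nat}" by auto
  have "z $ 1 \<noteq> 0" using Z by (auto simp: dot_def two flip_def)
  then have "g $ 1 = 0" using G by (auto simp: dot_def two)
  then show ?thesis using G by (intro eq_vecI) (auto simp: less_2_cases_iff)
qed

text \<open>Every subgroup \<open>M_real_at 2 z\<close> is trivial, so a reduced word has no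
  letters; yet every element is the product of a reduced word.\<close>

lemma trivial_M_real0_two: "trivial_group (M_real0_group 2)"
  unfolding trivial_group_def
proof
  have "U = 1\<^sub>m 2" if U: "U \<in> M_real0 2" for U
  proof -
    obtain w where w: "reduced_word (M_real0_group 2) (Xi_real 2) (M_real_at 2) w"
      "word_product (M_real0_group 2) w = U"
      using M_real0_reduced_word[OF _ U] by auto
    have "w = []"
    proof (rule ccontr)
      assume "w \<noteq> []"
      then obtain z h v where "w = (z, h) # v" by (metis list.exhaust prod.exhaust)
      then have z: "z \<in> Xi_real 2" and h: "h \<in> M_real_at 2 z" "h \<noteq> 1\<^sub>m 2"
        using w(1) by (auto simp: reduced_word_Cons M_def)
      then obtain g where "g \<in> Delta_real 2 z" "h = G_mat 2 z 0 g" by (auto simp: M_real_at_eq)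
      then show False using Delta_real_two[OF z] G_mat_zero[OF _ z] h by auto
    qed
    then show ?thesis using w(2) by (simp add: M_def)
  qed
  then show "carrier (M_real0_group 2) = {\<one>\<^bsub>M_real0_group 2\<^esub>}"
    using one_in_M_real0 by (auto simp: M_def)
qed (rule group_M_real0)

lemma nontrivial_M_real0:
  assumes "n > 2"
  shows "\<not> trivial_group (M_real0_group n)"
proof
  assume triv: "trivial_group (M_real0_group n)"
  have n: "0 < n" using assms by simp
  \<comment> \<open>From dimension three on there is room for a vector orthogonal to both
    \<open>z = (1, 1, 0, ...)\<close> and \<open>D z\<close>. Here \<open>g\<close> is \<omega>
    times the unit vector of coordinate 2, and entry \<open>(2, 0)\<close> of the resulting matrix
    is -\<omega>.\<close>
  define z :: "complex vec" where "z = vec n (\<lambda>i. if i \<le> 1 then 1 else 0)"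
  define g :: "complex poly vec" where "g = vec n (\<lambda>i. if i = 2 then [:0, 1:] else 0)"
  have "dot n (\<lambda>i. z $ i) (flip (\<lambda>i. z $ i)) = (\<Sum>i\<in>{0, 1 :: nat}. if i = 0 then - 1 else 1)"
    unfolding dot_def using assms by (intro sum.mono_neutral_cong_right) (auto simp: z_def flip_def)
  then have z: "z \<in> Xi_real n" using n assms by (auto simp: Xi_real_iff z_def)
  have "dot n (cvec z) (\<lambda>i. g $ i) = 0"
    unfolding dot_def using assms by (intro sum.neutral) (auto simp: z_def g_def)
  then have g: "g \<in> Delta_real n z"
    unfolding Delta_real_iff[OF n z] using assms
    by (auto simp: g_def poly_eq_iff coeff_conjugate_poly coeff_pCons split: nat.splits)
  have "G_mat n z 0 g = 1\<^sub>m n"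
    using G_mat_in_M_real0[OF n z g] triv by (auto simp: trivial_group_def M_def)
  moreover have "G_mat n z 0 g $$ (2, 0) = - [:0, 1:]"
    using assms unfolding G_mat_index[OF n z g assms n]
    by (simp add: g_def z_def flip_def)
  ultimately show False using assms by simp
qed

theorem theorem2:
  fixes \<nu> :: nat
  assumes "\<nu> \<ge> 2"
  shows "(\<nu> = 2 \<longrightarrow> trivial_group (M_real0_group \<nu>)) \<and>
    (\<nu> > 2 \<longrightarrow> \<not> trivial_group (M_real0_group \<nu>) \<and>
        is_free_product_of (M_real0_group \<nu>) (Xi_real \<nu>) (M_real_at \<nu>)) \<and>
    (\<forall>z\<in>Xi_real \<nu>. comm_group ((M_real0_group \<nu>)\<lparr>carrier := M_real_at \<nu> z\<rparr>))"
proof -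
  have "0 < \<nu>" using assms by simp
  then show ?thesis
    using trivial_M_real0_two nontrivial_M_real0 free_product_M_real0 comm_group_M_real_at by blast
qed

end
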